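(* Let $G \curvearrowright T$ be an action by automorphisms of a countable group $G$ on a countable tree $T$ (not necessarily locally finite, not necessarily free), and suppose that every infinite geodesic $\mathbf v$ in $T$ has a finite initial segment $\sigma$ with $\mathrm{Stab}_G(\sigma) = \mathrm{Stab}_G(\mathbf v)$. Then the orbit equivalence relation $E_G^{\partial T}$ of the induced action of $G$ on the boundary $\partial T$ is Borel hyperfinite.
   Context: A tree is a connected acyclic undirected simple graph. A geodesic in $T$ is a finite or infinite injective sequence of vertices with consecutive terms adjacent. $\mathrm{Geo}(T)\subseteq V(T)^{\mathbb N}$ is the standard Borel space (Borel subset of the product space, $V(T)$ discrete) of infinite geodesics. $\mathbb N$ acts on $\mathrm{Geo}(T)$ by the shift $(v_0,v_1,v_2,\dots)\mapsto(v_1,v_2,\dots)$; the boundary $\partial T$ is the quotient $\mathrm{Geo}(T)/\mathbb N$ by the equivalence relation generated by the shift (a standard Borel space). $G$ acts on geodesics coordinatewise, this commutes with the shift, and so descends to a Borel action on $\partial T$. For a (finite or infinite) geodesic $\sigma$, $\mathrm{Stab}_G(\sigma)=\{g\in G: g\sigma=\sigma\}$ (i.e. $g$ fixes every vertex of $\sigma$). For a group action, $E_G^X$ is its orbit equivalence relation. A countable Borel equivalence relation $E$ is Borel hyperfinite if $E=\bigcup_i E_i$ for an increasing sequence $(E_i)_{i\in\mathbb N}$ of countable Borel equivalence relations each having all classes finite. *)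

theory Defs
  imports "HOL-Probability.Probability" "HOL-Algebra.Group_Action"
begin

definition simple_graph :: "'v set \<Rightarrow> ('v \<Rightarrow> 'v \<Rightarrow> bool) \<Rightarrow> bool" where
  "simple_graph V adj \<longleftrightarrow>
     (\<forall>u v. adj u v \<longrightarrow> u \<in> V \<and> v \<in> V) \<and>
     (\<forall>u v. adj u v \<longrightarrow> adj v u) \<and>
     (\<forall>v. \<not> adj v v)"

definition is_walk :: "('v \<Rightarrow> 'v \<Rightarrow> bool) \<Rightarrow> 'v list \<Rightarrow> bool" where
  "is_walk adj xs \<longleftrightarrow> xs \<noteq> [] \<and> (\<forall>i. Suc i < length xs \<longrightarrow> adj (xs ! i) (xs ! Suc i))"

definition connected_graph :: "'v set \<Rightarrow> ('v \<Rightarrow> 'v \<Rightarrow> bool) \<Rightarrow> bool" where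
  "connected_graph V adj \<longleftrightarrow>
     (\<forall>u\<in>V. \<forall>v\<in>V. \<exists>xs. is_walk adj xs \<and> hd xs = u \<and> last xs = v)"

definition has_cycle :: "('v \<Rightarrow> 'v \<Rightarrow> bool) \<Rightarrow> bool" where
  "has_cycle adj \<longleftrightarrow>
     (\<exists>xs. length xs \<ge> 3 \<and> distinct xs \<and> is_walk adj xs \<and> adj (last xs) (hd xs))"

definition tree :: "'v set \<Rightarrow> ('v \<Rightarrow> 'v \<Rightarrow> bool) \<Rightarrow> bool" where
  "tree V adj \<longleftrightarrow> simple_graph V adj \<and> connected_graph V adj \<and> \<not> has_cycle adj"

definition geodesics :: "'v set \<Rightarrow> ('v \<Rightarrow> 'v \<Rightarrow> bool) \<Rightarrow> (nat \<Rightarrow> 'v) set" where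
  "geodesics V adj = {f. inj f \<and> (\<forall>n. f n \<in> V) \<and> (\<forall>n. adj (f n) (f (Suc n)))}"

definition Geo_space :: "'v set \<Rightarrow> ('v \<Rightarrow> 'v \<Rightarrow> bool) \<Rightarrow> (nat \<Rightarrow> 'v) measure" where
  "Geo_space V adj = restrict_space (PiM (UNIV :: nat set) (\<lambda>_. count_space V)) (geodesics V adj)"

definition shift_rel :: "'v set \<Rightarrow> ('v \<Rightarrow> 'v \<Rightarrow> bool) \<Rightarrow> ((nat \<Rightarrow> 'v) \<times> (nat \<Rightarrow> 'v)) set" where
  "shift_rel V adj = {(f, g). f \<in> geodesics V adj \<and> g \<in> geodesics V adj \<and>
       (\<exists>m n. (\<lambda>k. f (k + m)) = (\<lambda>k. g (k + n)))}"

definition boundary :: "'v set \<Rightarrow> ('v \<Rightarrow> 'v \<Rightarrow> bool) \<Rightarrow> (nat \<Rightarrow> 'v) set set" where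
  "boundary V adj = geodesics V adj // shift_rel V adj"

text \<open>The quotient Borel structure on the boundary: a set of classes is measurable
  iff its preimage (the union of the classes) is Borel in Geo(T).\<close>
definition boundary_space :: "'v set \<Rightarrow> ('v \<Rightarrow> 'v \<Rightarrow> bool) \<Rightarrow> (nat \<Rightarrow> 'v) set measure" where
  "boundary_space V adj = measure_of (boundary V adj)
     {A. A \<subseteq> boundary V adj \<and> \<Union>A \<in> sets (Geo_space V adj)} (\<lambda>_. 0)"

definition boundary_action :: "('g \<Rightarrow> 'v \<Rightarrow> 'v) \<Rightarrow> 'g \<Rightarrow> (nat \<Rightarrow> 'v) set \<Rightarrow> (nat \<Rightarrow> 'v) set" where
  "boundary_action \<phi> g x = (\<lambda>f. \<phi> g \<circ> f) ` x"

definition orbit_eqrel :: "('g, 'b) monoid_scheme \<Rightarrow> ('g \<Rightarrow> 'x \<Rightarrow> 'x) \<Rightarrow> 'x set \<Rightarrow> ('x \<times> 'x) set" where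
  "orbit_eqrel G act X = {(x, y). x \<in> X \<and> y \<in> X \<and> (\<exists>g\<in>carrier G. act g x = y)}"

definition stab_seq :: "('g, 'b) monoid_scheme \<Rightarrow> ('g \<Rightarrow> 'v \<Rightarrow> 'v) \<Rightarrow> (nat \<Rightarrow> 'v) \<Rightarrow> 'g set" where
  "stab_seq G \<phi> f = {g \<in> carrier G. \<forall>i. \<phi> g (f i) = f i}"

definition stab_prefix :: "('g, 'b) monoid_scheme \<Rightarrow> ('g \<Rightarrow> 'v \<Rightarrow> 'v) \<Rightarrow> (nat \<Rightarrow> 'v) \<Rightarrow> nat \<Rightarrow> 'g set" where
  "stab_prefix G \<phi> f n = {g \<in> carrier G. \<forall>i<n. \<phi> g (f i) = f i}"

definition borel_hyperfinite :: "'a measure \<Rightarrow> ('a \<times> 'a) set \<Rightarrow> bool" where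
  "borel_hyperfinite M E \<longleftrightarrow>
     (\<exists>F :: nat \<Rightarrow> ('a \<times> 'a) set. incseq F \<and> E = (\<Union>i. F i) \<and>
        (\<forall>i. equiv (space M) (F i) \<and> F i \<in> sets (M \<Otimes>\<^sub>M M) \<and>
             (\<forall>x\<in>space M. finite (F i `` {x}))))"

end

theory Submission
  imports Defs
begin

text \<open>
  By the stabilizer hypothesis, two rays are \<open>G\<close>-equivalent iff all their finite prefixes are,
  so the countably many \<open>G\<close>-invariant predicates ``the prefix lies in the orbit of a given word''
  separate the \<open>G\<close>-orbits of rays. On orbits of rays the relation to be analysed is tail
  equivalence, and the Dougherty--Jackson--Kechris argument applies: for each \<open>n\<close>, choose
  canonically an answer to the first \<open>n\<close> predicates which recurs along the ray, and cut the ray at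
  the first place where it occurs. Up to \<open>G\<close>, tail equivalent rays eventually have the same cut
  tails. So the relation is an increasing union of relations \<open>E\<^sub>n\<close> (``equal \<open>n\<close>-th tails''), and a
  natural number, again by the stabilizer hypothesis, recovers the \<open>n\<close>-th tail from the next one.
  Bounding these numbers cuts the \<open>E\<^sub>n\<close> down to relations with finite classes. The boundary is
  handled through the unique ray from a base vertex.
\<close>

section \<open>Hyperfiniteness from labelled increasing unions\<close>

text \<open>This is the argument for eventual equality on sequences of natural numbers: identify two
  points at stage \<open>n\<close> if, for some \<open>m \<le> n\<close>, they are \<open>E m\<close>-related and their first \<open>m\<close> labels are
  at most \<open>n\<close>.\<close>
lemma borel_hyperfinite_UN_labelled:
  fixes E :: "nat \<Rightarrow> ('a \<times> 'a) set" and l :: "nat \<Rightarrow> 'a \<Rightarrow> nat"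
  assumes eqv: "\<And>i. equiv (space M) (E i)"
    and meas: "\<And>i. E i \<in> sets (M \<Otimes>\<^sub>M M)"
    and mono: "\<And>i. E i \<subseteq> E (Suc i)"
    and E0: "E 0 \<subseteq> Id"
    and l_meas: "\<And>i. l i \<in> measurable M (count_space UNIV)"
    and l_inv: "\<And>i x y. (x, y) \<in> E i \<Longrightarrow> l i x = l i y"
    and l_sep: "\<And>i x y. (x, y) \<in> E (Suc i) \<Longrightarrow> l i x = l i y \<Longrightarrow> (x, y) \<in> E i"
  shows "borel_hyperfinite M (\<Union>i. E i)"
proof -
  have E_mono: "E i \<subseteq> E j" if "i \<le> j" for i j
    using that mono by (rule lift_Suc_mono_le[of E, rotated])
  have l_inv': "l i x = l i y" if "(x, y) \<in> E m" "m \<le> i" for i m x y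
    using l_inv E_mono that by blast
  \<comment> \<open>Bounding only the labels below \<open>m\<close> is enough on \<open>E m\<close>:
    by \<open>l_inv'\<close> the later ones are constant on its classes.\<close>
  define A where "A m n = {x \<in> space M. \<forall>i<m. l i x \<le> n}" for m n :: nat
  define F where "F n = (\<Union>m\<in>{..n}. E m \<inter> A m n \<times> A m n)" for n
  note l_meas[measurable]
  have A_meas: "A m n \<in> sets M" for m n
    unfolding A_def by measurable
  have F_meas: "F n \<in> sets (M \<Otimes>\<^sub>M M)" for n
    unfolding F_def using meas A_meas by (intro sets.finite_UN sets.Int) auto
  \<comment> \<open>The labels of \<open>z\<close> below \<open>k\<close> are bounded because
    \<open>z\<close> lies in \<open>A k n\<close>; from \<open>k\<close> on they are those of
    \<open>y\<close>. This is what makes \<open>F n\<close> transitive although \<open>A m n\<close>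
    shrinks as \<open>m\<close> grows.\<close>
  have A_trans: "z \<in> A m n" if "(y, z) \<in> E k" "k \<le> m" "y \<in> A m n" "z \<in> A k n" for y z k m n
    unfolding A_def
  proof (intro CollectI conjI allI impI)
    show "z \<in> space M" using that(4) by (simp add: A_def)
    show "l i z \<le> n" if "i < m" for i
    proof (cases "i < k")
      case True then show ?thesis using \<open>z \<in> A k n\<close> by (simp add: A_def)
    next
      case False
      then have "l i y = l i z" using l_inv' \<open>(y, z) \<in> E k\<close> by simp
      then show ?thesis using \<open>y \<in> A m n\<close> \<open>i < m\<close> by (auto simp: A_def)
    qed
  qed
  have E_sym: "(y, x) \<in> E i" if "(x, y) \<in> E i" for x y i
    using eqv[of i] that by (meson equivE symE)
  have E_trans: "(x, z) \<in> E i" if "(x, y) \<in> E i" "(y, z) \<in> E i" for x y z i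
    using eqv[of i] that by (meson equivE transE)
  have F_sym: "(y, x) \<in> F n" if "(x, y) \<in> F n" for x y n
    using that E_sym unfolding F_def by blast
  have F_trans_aux: "(x, z) \<in> F n"
    if "(x, y) \<in> E m" "x \<in> A m n" "y \<in> A m n" "(y, z) \<in> E k" "z \<in> A k n" "k \<le> m" "m \<le> n"
    for x y z k m n
  proof -
    have "z \<in> A m n" using A_trans that by blast
    moreover have "(x, z) \<in> E m" using E_trans E_mono that by blast
    ultimately show ?thesis unfolding F_def using that by blast
  qed
  have F_trans: "(x, z) \<in> F n" if "(x, y) \<in> F n" "(y, z) \<in> F n" for x y z n
  proof -
    obtain m where m: "m \<le> n" "(x, y) \<in> E m" "x \<in> A m n" "y \<in> A m n"
      using \<open>(x, y) \<in> F n\<close> unfolding F_def by blast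
    obtain k where k: "k \<le> n" "(y, z) \<in> E k" "y \<in> A k n" "z \<in> A k n"
      using \<open>(y, z) \<in> F n\<close> unfolding F_def by blast
    show ?thesis
    proof (cases "k \<le> m")
      case True then show ?thesis using F_trans_aux m k by blast
    next
      case False
      then have "(z, x) \<in> F n" using F_trans_aux[of z y k n x m] E_sym m k by auto
      then show ?thesis by (rule F_sym)
    qed
  qed
  have F_equiv: "equiv (space M) (F n)" for n
  proof (rule equivI)
    show "F n \<subseteq> space M \<times> space M" unfolding F_def A_def by blast
    show "refl_on (space M) (F n)"
    proof (rule refl_onI)
      fix x assume "x \<in> space M"
      then have "(x, x) \<in> E 0 \<inter> A 0 n \<times> A 0 n"
        using eqv[of 0] by (auto simp: A_def equiv_def refl_on_def)
      then show "(x, x) \<in> F n" unfolding F_def by blast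
    qed
    show "sym (F n)" using F_sym by (rule symI)
    show "trans (F n)" using F_trans by (rule transI)
  qed
  \<comment> \<open>Each agreeing label takes the pair down one stage by \<open>l_sep\<close>, until
    it lands in \<open>E 0\<close>, which is contained in \<open>Id\<close>.\<close>
  have desc: "y = z" if "(y, z) \<in> E m" "\<forall>i<m. l i y = l i z" for y z m
    using that
  proof (induction m)
    case 0 then show ?case using E0 by blast
  next
    case (Suc m) then show ?case using l_sep by auto
  qed
  \<comment> \<open>By \<open>desc\<close>, points of one \<open>E m\<close>-class are told apart by
    their first \<open>m\<close> labels; in \<open>A m n\<close> these form a word of length
    \<open>m\<close> over \<open>{..n}\<close>.\<close>
  have fin1: "finite {y. (x, y) \<in> E m \<and> y \<in> A m n}" (is "finite ?S") for x m n
  proof (rule inj_on_finite)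
    show "inj_on (\<lambda>y. map (\<lambda>i. l i y) [0..<m]) ?S"
    proof (rule inj_onI)
      fix y z assume *: "y \<in> ?S" "z \<in> ?S" "map (\<lambda>i. l i y) [0..<m] = map (\<lambda>i. l i z) [0..<m]"
      then have "(y, z) \<in> E m" using E_sym E_trans by blast
      then show "y = z" using desc *(3) by auto
    qed
    show "(\<lambda>y. map (\<lambda>i. l i y) [0..<m]) ` ?S \<subseteq> {xs. set xs \<subseteq> {..n} \<and> length xs = m}"
      by (auto simp: A_def)
    show "finite {xs. set xs \<subseteq> {..n} \<and> length xs = m}"
      by (rule finite_lists_length_eq) simp
  qed
  have fin: "finite (F n `` {x})" for n x
  proof (rule finite_subset)
    show "F n `` {x} \<subseteq> (\<Union>m\<in>{..n}. {y. (x, y) \<in> E m \<and> y \<in> A m n})"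
      unfolding F_def by blast
    show "finite \<dots>" using fin1 by blast
  qed
  have "incseq F"
  proof (rule incseq_SucI)
    show "F n \<subseteq> F (Suc n)" for n
    proof
      fix p assume "p \<in> F n"
      then obtain m where m: "m \<le> n" "p \<in> E m \<inter> A m n \<times> A m n" unfolding F_def by blast
      moreover have "A m n \<subseteq> A m (Suc n)" unfolding A_def by (auto intro: le_SucI)
      ultimately show "p \<in> F (Suc n)" unfolding F_def by (intro UN_I[of m]) auto
    qed
  qed
  moreover have "(\<Union>i. E i) = (\<Union>i. F i)"
  proof
    show "(\<Union>i. F i) \<subseteq> (\<Union>i. E i)" unfolding F_def by blast
    show "(\<Union>i. E i) \<subseteq> (\<Union>i. F i)"
    proof clarify
      fix m x y assume xy: "(x, y) \<in> E m"
      \<comment> \<open>The summand \<open>m\<close> makes stage \<open>m\<close> admissible in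
        \<open>F n\<close>; the sum bounds the first \<open>m\<close> labels of both points.\<close>
      define n where "n = m + (\<Sum>i<m. l i x + l i y)"
      have sp: "x \<in> space M" "y \<in> space M" using xy eqv[of m] by (auto simp: equiv_def)
      have le: "l i x + l i y \<le> n" if "i < m" for i
        using member_le_sum[of i "{..<m}" "\<lambda>i. l i x + l i y"] that by (auto simp: n_def)
      have "x \<in> A m n" "y \<in> A m n"
        using sp le unfolding A_def by force+
      then have "(x, y) \<in> F n" using xy unfolding F_def n_def by force
      then show "(x, y) \<in> (\<Union>i. F i)" by blast
    qed
  qed
  ultimately show ?thesis
    unfolding borel_hyperfinite_def using F_equiv F_meas fin by (intro exI[of _ F]) simp
qed

section \<open>Sequences and rays in trees\<close>

text \<open>A shift loses only elements below \<open>m\<close>. Hence recurring infinitely often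
  along a ray is a tail invariant notion.\<close>

lemma finite_add_iff: "finite {k. k + m \<in> A} \<longleftrightarrow> finite (A :: nat set)"
proof -
  have "A \<subseteq> {..<m} \<union> (\<lambda>k. k + m) ` {k. k + m \<in> A}"
  proof
    fix x assume "x \<in> A"
    then show "x \<in> {..<m} \<union> (\<lambda>k. k + m) ` {k. k + m \<in> A}"
      by (cases "x < m") (auto intro!: image_eqI[of _ _ "x - m"])
  qed
  then have "finite {k. k + m \<in> A} \<Longrightarrow> finite A"
    by (meson finite_Un finite_imageI finite_lessThan finite_subset)
  moreover have "finite A \<Longrightarrow> finite {k. k + m \<in> A}"
    by (rule finite_imageD[of "\<lambda>k. k + m"]) (auto intro: finite_subset inj_onI)
  ultimately show ?thesis by blast
qed

definition seq_drop :: "nat \<Rightarrow> (nat \<Rightarrow> 'a) \<Rightarrow> nat \<Rightarrow> 'a" where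
  "seq_drop m f = (\<lambda>k. f (k + m))"

lemma seq_drop_apply [simp]: "seq_drop m f k = f (k + m)"
  by (simp add: seq_drop_def)

lemma seq_drop_0 [simp]: "seq_drop 0 f = f"
  by (simp add: seq_drop_def)

lemma seq_drop_seq_drop [simp]: "seq_drop m (seq_drop n f) = seq_drop (m + n) f"
  by (simp add: seq_drop_def add.assoc)

lemma geodesics_seq_drop: "f \<in> geodesics V adj \<Longrightarrow> seq_drop m f \<in> geodesics V adj"
  unfolding geodesics_def inj_def by simp (metis add_right_cancel)

lemma geodesics_in_vertices: "f \<in> geodesics V adj \<Longrightarrow> f k \<in> V"
  unfolding geodesics_def by auto

lemma shift_rel_iff:
  "(f, f') \<in> shift_rel V adj \<longleftrightarrow>
     f \<in> geodesics V adj \<and> f' \<in> geodesics V adj \<and> (\<exists>m n. seq_drop m f = seq_drop n f')"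
  by (simp add: shift_rel_def seq_drop_def)

lemma equiv_shift_rel: "equiv (geodesics V adj) (shift_rel V adj)"
proof (rule equivI)
  show "shift_rel V adj \<subseteq> geodesics V adj \<times> geodesics V adj"
    by (auto simp: shift_rel_iff)
  show "refl_on (geodesics V adj) (shift_rel V adj)"
    by (auto simp: refl_on_def shift_rel_iff)
  show "sym (shift_rel V adj)"
    unfolding sym_def shift_rel_iff by metis
  show "trans (shift_rel V adj)"
  proof (rule transI)
    fix f g h assume "(f, g) \<in> shift_rel V adj" "(g, h) \<in> shift_rel V adj"
    then obtain a b c d where *: "f \<in> geodesics V adj" "h \<in> geodesics V adj"
      "seq_drop a f = seq_drop b g" "seq_drop c g = seq_drop d h"
      by (auto simp: shift_rel_iff)
    \<comment> \<open>Shifts commute, so dropping \<open>b + c\<close> entries of \<open>g\<close>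
      gives a tail common to both relations.\<close>
    have "seq_drop (c + a) f = seq_drop c (seq_drop b g)" using *(3) by (metis seq_drop_seq_drop)
    also have "\<dots> = seq_drop b (seq_drop c g)" by (simp add: add.commute)
    also have "\<dots> = seq_drop (b + d) h" using *(4) by simp
    finally show "(f, h) \<in> shift_rel V adj" using *(1,2) by (auto simp: shift_rel_iff)
  qed
qed

section \<open>Rays with a prescribed first vertex\<close>

lemma is_walk_append:
  assumes "is_walk adj xs" "is_walk adj ys" "adj (last xs) (hd ys)"
  shows "is_walk adj (xs @ ys)"
  unfolding is_walk_def
proof (intro conjI allI impI)
  show "xs @ ys \<noteq> []" using assms(1) by (simp add: is_walk_def)
  have ne: "xs \<noteq> []" "ys \<noteq> []" using assms by (auto simp: is_walk_def)
  fix i assume i: "Suc i < length (xs @ ys)"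
  consider "Suc i < length xs" | "Suc i = length xs" | "Suc i > length xs" by linarith
  then show "adj ((xs @ ys) ! i) ((xs @ ys) ! Suc i)"
  proof cases
    case 1 then show ?thesis using assms(1) by (simp add: is_walk_def nth_append)
  next
    case 2
    then have "last xs = xs ! i" using ne by (metis diff_Suc_1 last_conv_nth)
    then show ?thesis using 2 assms(3) ne by (simp add: nth_append hd_conv_nth)
  next
    case 3
    then have "Suc i - length xs = Suc (i - length xs)" by simp
    then show ?thesis using 3 i assms(2) by (simp add: is_walk_def nth_append)
  qed
qed

text \<open>If the two rays separated after a common vertex, the segments up to the first vertex
  where they meet again would form a cycle.\<close>
lemma geodesics_eqI:
  assumes tree: "tree V adj"
    and f: "f \<in> geodesics V adj" and f': "f' \<in> geodesics V adj"
    and start: "f 0 = f' 0" and tail: "seq_drop m f = seq_drop n f'"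
  shows "f = f'"
proof (rule ccontr)
  assume "f \<noteq> f'"
  then have ex: "\<exists>k. f k \<noteq> f' k" by auto
  define k0 where "k0 = (LEAST k. f k \<noteq> f' k)"
  have k0: "f k0 \<noteq> f' k0" and least: "\<And>k. k < k0 \<Longrightarrow> f k = f' k"
    unfolding k0_def using LeastI_ex[OF ex] not_less_Least by auto
  have "k0 \<noteq> 0" using k0 start by metis
  \<comment> \<open>At index \<open>a\<close> the rays still agree; they separate at the next
    step.\<close>
  then obtain a where a: "k0 = Suc a" by (cases k0) auto
  have inj: "inj f" "inj f'" using f f' by (auto simp: geodesics_def)
  have adjf: "\<And>i. adj (f i) (f (Suc i))" "\<And>i. adj (f' i) (f' (Suc i))"
    using f f' by (auto simp: geodesics_def)
  have sym: "\<And>u v. adj u v \<Longrightarrow> adj v u" using tree by (auto simp: tree_def simple_graph_def)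
  have fa: "f a = f' a" using least a by simp
  define P where "P b \<longleftrightarrow> b > a \<and> (\<exists>c>a. f b = f' c)" for b
  \<comment> \<open>The common tail guarantees that \<open>f\<close> meets the part of
    \<open>f'\<close> beyond \<open>a\<close> again.\<close>
  have "f (Suc a + m) = f' (Suc a + n)" using fun_cong[OF tail, of "Suc a"] by simp
  then have "P (Suc a + m)" unfolding P_def by (intro conjI exI[of _ "Suc a + n"]) auto
  define b where "b = (LEAST b. P b)"
  have "P b" unfolding b_def using \<open>P (Suc a + m)\<close> by (rule LeastI)
  then obtain c where b: "b > a" and c: "c > a" "f b = f' c" unfolding P_def by auto
  have least_b: "f i \<noteq> f' j" if "a < i" "i < b" "a < j" for i j
    using not_less_Least[of i P] that unfolding b_def P_def by auto
  \<comment> \<open>The cycle runs along \<open>f\<close> from \<open>a\<close> to \<open>b\<close>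
    and returns along \<open>f'\<close> from \<open>c - 1\<close> to \<open>Suc a\<close>; both
    shared endpoints are kept in \<open>xs\<close> only.\<close>
  define xs where "xs = map f [a..<Suc b]"
  define ys where "ys = rev (map f' [Suc a..<c])"
  have hd: "hd (xs @ ys) = f a" unfolding xs_def using b by (simp add: hd_append upt_rec)
  have dist: "distinct (xs @ ys)"
  proof -
    have "distinct xs" "distinct ys"
      unfolding xs_def ys_def using inj by (auto simp: distinct_map inj_on_def)
    moreover have False if ij: "i \<in> {a..b}" "j \<in> {Suc a..<c}" "f i = f' j" for i j
    proof -
      consider "i = a" | "i = b" | "a < i" "i < b" using ij by force
      then show False
      proof cases
        case 1 then show False using ij fa inj(2) by (auto dest: injD)
      next
        case 2 then show False using ij c inj(2) by (auto dest: injD)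
      next
        case 3 then show False using ij least_b by auto
      qed
    qed
    moreover have "set xs = f ` {a..b}" "set ys = f' ` {Suc a..<c}"
      unfolding xs_def ys_def set_rev set_map set_upt by auto
    ultimately show ?thesis by (auto simp only: distinct_append)
  qed
  \<comment> \<open>A shorter list would force \<open>b = c = Suc a\<close>, so the rays would agree
    at \<open>k0\<close>.\<close>
  have len: "length (xs @ ys) \<ge> 3"
  proof (rule ccontr)
    assume "\<not> ?thesis"
    then have "b = Suc a" "c = Suc a" using b c by (auto simp: xs_def ys_def)
    then show False using c k0 a by simp
  qed
  have wx: "is_walk adj xs"
    unfolding is_walk_def xs_def using b adjf(1) by (auto simp del: upt_Suc)
  have lx: "last xs = f' c" unfolding xs_def using b c by (simp add: last_map)
  have "is_walk adj (xs @ ys) \<and> adj (last (xs @ ys)) (f a)"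
  proof (cases "c = Suc a")
    case True
    then show ?thesis using wx lx sym[OF adjf(2)[of a]] fa by (simp add: ys_def)
  next
    case False
    then have "Suc a < c" using c by simp
    have ne: "ys \<noteq> []" using \<open>Suc a < c\<close> by (simp add: ys_def)
    have nth: "ys ! i = f' (c - Suc i)" if "i < length ys" for i
      using that by (simp add: ys_def rev_nth Suc_diff_Suc)
    have "is_walk adj ys"
      unfolding is_walk_def
    proof (intro conjI allI impI ne)
      fix i assume i: "Suc i < length ys"
      then have "c - Suc i = Suc (c - Suc (Suc i))" by (simp add: ys_def)
      then show "adj (ys ! i) (ys ! Suc i)"
        using nth i sym[OF adjf(2)] by simp
    qed
    moreover have "hd ys = f' (c - 1)" using nth[of 0] ne by (simp add: hd_conv_nth)
    then have "adj (last xs) (hd ys)" using lx sym[OF adjf(2)[of "c - 1"]] c by simp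
    moreover have "last ys = f' (Suc a)" using \<open>Suc a < c\<close> by (simp add: ys_def last_rev hd_map)
    ultimately show ?thesis
      using is_walk_append[OF wx] ne fa sym[OF adjf(2)[of a]] by simp
  qed
  then have "has_cycle adj" unfolding has_cycle_def using len dist hd by metis
  then show False using tree by (simp add: tree_def)
qed

definition seq_append :: "'a list \<Rightarrow> (nat \<Rightarrow> 'a) \<Rightarrow> nat \<Rightarrow> 'a" where
  "seq_append xs f i = (if i < length xs then xs ! i else f (i - length xs))"

lemma seq_drop_seq_append [simp]: "seq_drop (length xs) (seq_append xs f) = f"
  by (auto simp: seq_append_def)

lemma seq_append_prefix_seq_drop: "seq_append (map f [0..<n]) (seq_drop n f) = f"
  by (auto simp: seq_append_def)

text \<open>Prolong a shortest walk from \<open>u\<close> to a vertex of the ray: minimality makes it injective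
  and disjoint from the rest of the ray.\<close>
lemma ex_geodesic_from:
  assumes tree: "tree V adj" and f: "f \<in> geodesics V adj" and u: "u \<in> V"
  shows "\<exists>h\<in>geodesics V adj. h 0 = u \<and> (\<exists>m n. seq_drop m h = seq_drop n f)"
proof -
  define P where "P xs \<longleftrightarrow> is_walk adj xs \<and> hd xs = u \<and> last xs \<in> range f" for xs
  have "\<exists>xs. P xs"
    using tree u geodesics_in_vertices[OF f, of 0]
    unfolding P_def tree_def connected_graph_def by blast
  then obtain xs where xs: "P xs" and min: "\<And>ys. P ys \<Longrightarrow> length xs \<le> length ys"
    using exists_least_iff[of "\<lambda>n. \<exists>xs. P xs \<and> length xs = n"] by (metis not_less)
  have ne: "xs \<noteq> []" and walk: "\<And>i. Suc i < length xs \<Longrightarrow> adj (xs ! i) (xs ! Suc i)"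
    and hd: "hd xs = u" using xs by (auto simp: P_def is_walk_def)
  obtain n where n: "last xs = f n" using xs by (auto simp: P_def)
  have injf: "inj f" and adjf: "\<And>i. adj (f i) (f (Suc i))" using f by (auto simp: geodesics_def)
  have take: "is_walk adj (take (Suc i) xs)" "hd (take (Suc i) xs) = u"
    "last (take (Suc i) xs) = xs ! i" if "i < length xs" for i
    using ne hd walk that by (auto simp: is_walk_def) (simp add: take_Suc_conv_app_nth)
  \<comment> \<open>A walk touching the ray before its last vertex could be stopped there, against
    minimality.\<close>
  have notin: "xs ! i \<noteq> f j" if "Suc i < length xs" for i j
  proof
    assume "xs ! i = f j"
    then have "P (take (Suc i) xs)"
      using that take[of i] by (auto simp: P_def)
    then show False using min[of "take (Suc i) xs"] that by simp
  qed
  have dist: "xs ! i \<noteq> xs ! j" if "i < j" "j < length xs" for i j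
  proof
    assume eq: "xs ! i = xs ! j"
    \<comment> \<open>Cutting out the loop between two equal vertices leaves a shorter walk with the
      same ends.\<close>
    let ?ys = "take (Suc i) xs @ drop (Suc j) xs"
    have "P ?ys"
    proof (cases "Suc j < length xs")
      case True
      have "is_walk adj (take (Suc i) xs)" "is_walk adj (drop (Suc j) xs)"
        using walk that True take[of i] by (auto simp: is_walk_def)
      moreover have "adj (last (take (Suc i) xs)) (hd (drop (Suc j) xs))"
        using walk[OF True] that True eq take[of i] by (simp add: hd_drop_conv_nth)
      ultimately have "is_walk adj ?ys" by (rule is_walk_append)
      then show ?thesis using xs ne that True by (auto simp: P_def hd_append)
    next
      case False
      then have "xs ! j = last xs" using that by (metis Suc_lessI diff_Suc_1 last_conv_nth ne)
      then show ?thesis using False that eq xs take[of i] by (auto simp: P_def)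
    qed
    then show False using min[of ?ys] that by simp
  qed
  \<comment> \<open>The last vertex of the walk is \<open>f n\<close>, which the tail already
    supplies; hence \<open>butlast\<close>.\<close>
  define h where "h = seq_append (butlast xs) (seq_drop n f)"
  have hx: "h i = xs ! i" if "i < length xs" for i
  proof (cases "Suc i < length xs")
    case True then show ?thesis by (simp add: h_def seq_append_def nth_butlast less_diff_conv)
  next
    case False
    then have "i = length xs - 1" using that by simp
    then show ?thesis using n ne by (simp add: h_def seq_append_def last_conv_nth)
  qed
  have hf: "h i = f (i - (length xs - 1) + n)" if "Suc i \<ge> length xs" for i
    using that by (auto simp: h_def seq_append_def)
  have "inj h"
  proof (rule linorder_injI)
    fix i j :: nat assume "i < j"
    consider "j < length xs" | "Suc i < length xs" "length xs \<le> j" | "length xs \<le> Suc i"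
      using \<open>i < j\<close> by linarith
    then show "h i \<noteq> h j"
    proof cases
      case 1 then show ?thesis using dist \<open>i < j\<close> hx by simp
    next
      case 2 then show ?thesis using notin hx hf by simp
    next
      case 3 then show ?thesis using hf \<open>i < j\<close> injf by (auto dest: injD)
    qed
  qed
  moreover have "adj (h i) (h (Suc i))" for i
  proof (cases "Suc i < length xs")
    case True then show ?thesis using hx walk by simp
  next
    case False
    then have "Suc i - (length xs - 1) + n = Suc (i - (length xs - 1) + n)" using ne by (cases xs) auto
    then show ?thesis using hf[of i] hf[of "Suc i"] adjf False by (simp del: One_nat_def)
  qed
  moreover have "h i \<in> V" for i
    using \<open>adj (h i) (h (Suc i))\<close> tree unfolding tree_def simple_graph_def by blast
  ultimately have "h \<in> geodesics V adj" by (auto simp: geodesics_def)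
  moreover have "h 0 = u" using hx[of 0] ne hd by (simp add: hd_conv_nth)
  moreover have "seq_drop (length (butlast xs)) h = seq_drop n f"
    unfolding h_def by (rule seq_drop_seq_append)
  ultimately show ?thesis by blast
qed

section \<open>Measurability on the boundary\<close>

lemma space_Geo_space: "space (Geo_space V adj) = geodesics V adj"
  unfolding Geo_space_def by (auto simp: space_restrict_space space_PiM geodesics_def)

text \<open>The generating family is already a sigma-algebra: distinct classes are disjoint, so
  taking the union of the classes commutes with complements as well as with countable
  unions.\<close>

lemma sets_boundary_space:
  "sets (boundary_space V adj) = {A. A \<subseteq> boundary V adj \<and> \<Union>A \<in> sets (Geo_space V adj)}"
  and space_boundary_space: "space (boundary_space V adj) = boundary V adj"
proof -
  let ?S = "{A. A \<subseteq> boundary V adj \<and> \<Union>A \<in> sets (Geo_space V adj)}"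
  have Un: "\<Union>(boundary V adj) = geodesics V adj"
    unfolding boundary_def by (rule Union_quotient[OF equiv_shift_rel])
  have "sigma_algebra (boundary V adj) ?S"
    unfolding sigma_algebra_iff2
  proof (intro conjI ballI allI impI)
    fix A assume A: "A \<in> ?S"
    have "\<Union>(boundary V adj - A) = geodesics V adj - \<Union>A"
    proof
      show "geodesics V adj - \<Union>A \<subseteq> \<Union>(boundary V adj - A)" using Un by blast
      show "\<Union>(boundary V adj - A) \<subseteq> geodesics V adj - \<Union>A"
      proof
        fix f assume "f \<in> \<Union>(boundary V adj - A)"
        then obtain x where x: "x \<in> boundary V adj" "x \<notin> A" "f \<in> x" by blast
        have "f \<notin> y" if "y \<in> A" for y
        proof
          assume "f \<in> y"
          then have "x = y"
            using quotient_disj[OF equiv_shift_rel, of x V adj y] A that x unfolding boundary_def by blast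
          then show False using that x by simp
        qed
        then show "f \<in> geodesics V adj - \<Union>A" using x Un by blast
      qed
    qed
    then show "boundary V adj - A \<in> ?S" using A sets.compl_sets[of "\<Union>A" "Geo_space V adj"]
      by (auto simp: space_Geo_space)
  next
    fix A :: "nat \<Rightarrow> (nat \<Rightarrow> 'a) set set" assume A: "range A \<subseteq> ?S"
    have "\<Union>(\<Union>i. A i) = (\<Union>i. \<Union>(A i))" by blast
    also have "\<dots> \<in> sets (Geo_space V adj)" using A by (intro sets.countable_UN) auto
    finally show "(\<Union>i. A i) \<in> ?S" using A by auto
  qed auto
  then interpret sigma_algebra "boundary V adj" ?S .
  show "sets (boundary_space V adj) = ?S" "space (boundary_space V adj) = boundary V adj"
    unfolding boundary_space_def by simp_all
qed

lemma measurable_Geo_component: "(\<lambda>f. f i) \<in> measurable (Geo_space V adj) (count_space V)"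
  unfolding Geo_space_def
  by (rule measurable_restrict_space1, rule measurable_component_singleton) simp

text \<open>Splitting over the countably many values of \<open>u\<close> leaves a function of
  \<open>w\<close> alone, and every map between count spaces is measurable.\<close>

lemma measurable_count_space_apply2:
  assumes "countable A" "u \<in> measurable N (count_space A)" "w \<in> measurable N (count_space B)"
    and "\<And>a b. a \<in> A \<Longrightarrow> b \<in> B \<Longrightarrow> h a b \<in> C"
  shows "(\<lambda>x. h (u x) (w x)) \<in> measurable N (count_space C)"
proof (rule measurable_compose_countable'[OF _ assms(2,1), where f = "\<lambda>a x. h a (w x)"])
  show "(\<lambda>x. h a (w x)) \<in> measurable N (count_space C)" if "a \<in> A" for a
    by (rule measurable_compose[OF assms(3)]) (use assms(4) that in auto)
qed

lemma pred_countable_Ball: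
  "countable I \<Longrightarrow> (\<And>i. i \<in> I \<Longrightarrow> Measurable.pred N (P i)) \<Longrightarrow> Measurable.pred N (\<lambda>x. \<forall>i\<in>I. P i x)"
  unfolding pred_def by (rule sets.sets_Collect_countable_All')

lemma pred_countable_Bex:
  "countable I \<Longrightarrow> (\<And>i. i \<in> I \<Longrightarrow> Measurable.pred N (P i)) \<Longrightarrow> Measurable.pred N (\<lambda>x. \<exists>i\<in>I. P i x)"
  unfolding pred_def by (rule sets.sets_Collect_countable_Ex')

section \<open>Cutting rays at recurrent positions\<close>

locale tree_action =
  fixes G :: "('g, 'b) monoid_scheme" (structure)
    and V :: "'v set" and adj :: "'v \<Rightarrow> 'v \<Rightarrow> bool"
    and \<phi> :: "'g \<Rightarrow> 'v \<Rightarrow> 'v"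
  assumes countable_G: "countable (carrier G)"
    and countable_V: "countable V"
    and tree: "tree V adj"
    and action: "group_action G V \<phi>"
    and adj_iff: "\<And>g u v. g \<in> carrier G \<Longrightarrow> u \<in> V \<Longrightarrow> v \<in> V \<Longrightarrow> adj u v \<longleftrightarrow> adj (\<phi> g u) (\<phi> g v)"
    and stab: "\<And>f. f \<in> geodesics V adj \<Longrightarrow> \<exists>n. stab_prefix G \<phi> f n = stab_seq G \<phi> f"
begin

abbreviation "Geo \<equiv> geodesics V adj"

section \<open>Elementary facts about the action\<close>

lemma group_G: "group G"
  using action by (simp add: group_action_def group_hom_def)

lemma act_closed: "g \<in> carrier G \<Longrightarrow> v \<in> V \<Longrightarrow> \<phi> g v \<in> V"
  using group_action.element_image[OF action] by blast

lemma act_one: "v \<in> V \<Longrightarrow> \<phi> \<one> v = v"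
  using group_action.id_eq_one[OF action] by (metis restrict_apply')

lemma act_mult: "g \<in> carrier G \<Longrightarrow> h \<in> carrier G \<Longrightarrow> v \<in> V \<Longrightarrow> \<phi> (g \<otimes> h) v = \<phi> g (\<phi> h v)"
  using group_action.composition_rule[OF action] by blast

lemma act_inv: "g \<in> carrier G \<Longrightarrow> v \<in> V \<Longrightarrow> \<phi> g v = w \<Longrightarrow> \<phi> (inv g) w = v"
  using group_action.orbit_sym_aux[OF action] by blast

lemma act_inv_act: "g \<in> carrier G \<Longrightarrow> v \<in> V \<Longrightarrow> \<phi> (inv g) (\<phi> g v) = v"
  by (rule act_inv) auto

lemma act_inj: "g \<in> carrier G \<Longrightarrow> u \<in> V \<Longrightarrow> v \<in> V \<Longrightarrow> \<phi> g u = \<phi> g v \<Longrightarrow> u = v"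
  using act_inv by metis

lemmas G_closed = group.is_monoid[OF group_G, THEN monoid.m_closed]
  group.inv_closed[OF group_G] group.is_monoid[OF group_G, THEN monoid.one_closed]

lemma act_geodesic: "g \<in> carrier G \<Longrightarrow> f \<in> Geo \<Longrightarrow> \<phi> g \<circ> f \<in> Geo"
  unfolding geodesics_def inj_def
  by (simp add: act_closed flip: adj_iff) (metis act_inj)

section \<open>Orbit equivalence of rays, tested on prefixes\<close>

definition geq :: "(nat \<Rightarrow> 'v) \<Rightarrow> (nat \<Rightarrow> 'v) \<Rightarrow> bool" where
  "geq f f' \<longleftrightarrow> f \<in> Geo \<and> f' \<in> Geo \<and> (\<exists>g\<in>carrier G. \<forall>k. \<phi> g (f k) = f' k)"

lemma geqI: "f \<in> Geo \<Longrightarrow> f' \<in> Geo \<Longrightarrow> g \<in> carrier G \<Longrightarrow> (\<And>k. \<phi> g (f k) = f' k) \<Longrightarrow> geq f f'"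
  by (auto simp: geq_def)

lemma geq_Geo: "geq f f' \<Longrightarrow> f \<in> Geo" "geq f f' \<Longrightarrow> f' \<in> Geo"
  by (auto simp: geq_def)

lemma geq_refl: "f \<in> Geo \<Longrightarrow> geq f f"
  by (rule geqI[of _ _ \<one>]) (auto simp: act_one geodesics_in_vertices G_closed)

lemma geq_sym: "geq f f' \<Longrightarrow> geq f' f"
  unfolding geq_def using act_inv G_closed geodesics_in_vertices by metis

lemma geq_trans: "geq f f' \<Longrightarrow> geq f' f'' \<Longrightarrow> geq f f''"
proof -
  assume "geq f f'" "geq f' f''"
  then obtain g h where *: "g \<in> carrier G" "h \<in> carrier G" "f \<in> Geo" "f'' \<in> Geo"
    "\<And>k. \<phi> g (f k) = f' k" "\<And>k. \<phi> h (f' k) = f'' k"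
    unfolding geq_def by blast
  then show ?thesis
    by (intro geqI[of _ _ "h \<otimes> g"]) (auto simp: G_closed act_mult geodesics_in_vertices)
qed

lemma geq_seq_drop: "geq f f' \<Longrightarrow> geq (seq_drop m f) (seq_drop m f')"
  unfolding geq_def using geodesics_seq_drop by auto

text \<open>The element \<open>inv g \<otimes> h\<close> fixes the first \<open>n\<close> vertices,
  hence the whole ray. In this form the stabilizer hypothesis enters the argument: the action of an
  element on a ray is determined by its action on a stabilizing prefix.\<close>

lemma stab_prefix_extend:
  assumes f: "f \<in> Geo" and n: "stab_prefix G \<phi> f n = stab_seq G \<phi> f"
    and g: "g \<in> carrier G" and h: "h \<in> carrier G" and eq: "\<And>i. i < n \<Longrightarrow> \<phi> g (f i) = \<phi> h (f i)"
  shows "\<phi> g (f k) = \<phi> h (f k)"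
proof -
  have inV: "f i \<in> V" for i using f by (rule geodesics_in_vertices)
  have "\<phi> (inv g \<otimes> h) (f i) = f i" if "i < n" for i
    using g h inV by (simp add: act_mult G_closed act_inv_act flip: eq[OF that])
  then have "inv g \<otimes> h \<in> stab_prefix G \<phi> f n"
    using g h by (auto simp: stab_prefix_def G_closed)
  then have "\<phi> (inv g) (\<phi> h (f k)) = f k"
    using n g h inV by (auto simp: stab_seq_def act_mult G_closed)
  then have "\<phi> (inv g) (\<phi> h (f k)) = \<phi> (inv g) (\<phi> g (f k))"
    using act_inv_act g inV by simp
  then show ?thesis using act_inj g h inV by (metis G_closed(2) act_closed)
qed

text \<open>An element matching a stabilizing prefix matches everything: for position
  \<open>k\<close>, compare it by \<open>stab_prefix_extend\<close> with an element that matches a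
  prefix reaching beyond \<open>k\<close>.\<close>

lemma geq_if_prefixes:
  assumes f: "f \<in> Geo" and f': "f' \<in> Geo"
    and pre: "\<And>n. \<exists>g\<in>carrier G. \<forall>i<n. \<phi> g (f i) = f' i"
  shows "geq f f'"
proof -
  obtain n where n: "stab_prefix G \<phi> f n = stab_seq G \<phi> f" using stab[OF f] by blast
  obtain g where g: "g \<in> carrier G" "\<forall>i<n. \<phi> g (f i) = f' i" using pre by blast
  show ?thesis
  proof (rule geqI[OF f f' g(1)])
    fix k
    obtain h where h: "h \<in> carrier G" "\<forall>i<max n (Suc k). \<phi> h (f i) = f' i" using pre by blast
    have "\<phi> g (f k) = \<phi> h (f k)"
      by (rule stab_prefix_extend[OF f n g(1) h(1)]) (use g h in auto)
    then show "\<phi> g (f k) = f' k" using h by simp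
  qed
qed

section \<open>Invariant predicates given by orbits of words\<close>

definition wordn :: "nat \<Rightarrow> 'v list" where
  "wordn = from_nat_into (lists V)"

lemma wordn_lists: "wordn j \<in> lists V"
  unfolding wordn_def by (rule from_nat_into) auto

lemma ex_wordn: "xs \<in> lists V \<Longrightarrow> \<exists>j. wordn j = xs"
  unfolding wordn_def using countable_V by (metis countable_lists from_nat_into_surj)

definition ptype :: "nat \<Rightarrow> (nat \<Rightarrow> 'v) \<Rightarrow> bool" where
  "ptype j f \<longleftrightarrow> (\<exists>g\<in>carrier G. map (\<phi> g) (wordn j) = map f [0..<length (wordn j)])"

lemma ptype_mono: "geq f f' \<Longrightarrow> ptype j f \<Longrightarrow> ptype j f'"
proof -
  assume "geq f f'" "ptype j f"
  then obtain g h where *: "g \<in> carrier G" "h \<in> carrier G" "f \<in> Geo"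
    "\<And>k. \<phi> g (f k) = f' k" "map (\<phi> h) (wordn j) = map f [0..<length (wordn j)]"
    unfolding geq_def ptype_def by blast
  have "map (\<phi> (g \<otimes> h)) (wordn j) = map (\<phi> g) (map (\<phi> h) (wordn j))"
    using wordn_lists[of j] *(1,2) by (auto simp: act_mult)
  also have "\<dots> = map f' [0..<length (wordn j)]" using *(4) unfolding *(5) by simp
  finally show ?thesis unfolding ptype_def using * by (auto simp: G_closed)
qed

lemma ptype_cong: "geq f f' \<Longrightarrow> ptype j f \<longleftrightarrow> ptype j f'"
  using ptype_mono geq_sym by blast

lemma geq_if_ptype:
  assumes f: "f \<in> Geo" and f': "f' \<in> Geo" and eq: "\<And>j. ptype j f \<longleftrightarrow> ptype j f'"
  shows "geq f f'"
proof (rule geq_if_prefixes[OF f f'])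
  fix n
  have "map f [0..<n] \<in> lists V" using geodesics_in_vertices[OF f] by auto
  \<comment> \<open>The predicate for the prefix of \<open>f\<close> itself holds at
    \<open>f\<close> through \<open>\<one>\<close>; transferred to \<open>f'\<close>, it yields the
    element sought.\<close>
  then obtain j where j: "wordn j = map f [0..<n]" using ex_wordn by blast
  have "ptype j f" unfolding ptype_def j
    by (rule bexI[of _ \<one>]) (auto simp: act_one geodesics_in_vertices[OF f] G_closed)
  then have "ptype j f'" using eq by simp
  then show "\<exists>g\<in>carrier G. \<forall>i<n. \<phi> g (f i) = f' i"
    unfolding ptype_def j by fastforce
qed

text \<open>Positions whose tails give the chosen answers to the predicates \<open>ptype j\<close>, \<open>j < n\<close>: the next
  answer is \<open>True\<close> whenever it recurs among the positions kept so far.\<close>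
primrec rpos :: "(nat \<Rightarrow> 'v) \<Rightarrow> nat \<Rightarrow> nat set" where
  "rpos f 0 = UNIV"
| "rpos f (Suc n) = (if infinite {k \<in> rpos f n. ptype n (seq_drop k f)}
     then {k \<in> rpos f n. ptype n (seq_drop k f)}
     else {k \<in> rpos f n. \<not> ptype n (seq_drop k f)})"

lemma infinite_rpos: "infinite (rpos f n)"
proof (induction n)
  case (Suc n)
  have "rpos f n = {k \<in> rpos f n. ptype n (seq_drop k f)} \<union> {k \<in> rpos f n. \<not> ptype n (seq_drop k f)}"
    by blast
  then show ?case using Suc by (metis (no_types, lifting) infinite_Un rpos.simps(2))
qed simp

lemma rpos_Suc_subset: "rpos f (Suc n) \<subseteq> rpos f n"
  by auto

text \<open>By \<open>finite_add_iff\<close> the drop does not change which answer recurs, so a ray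
  and its tails make the same choices.\<close>

lemma rpos_seq_drop: "rpos (seq_drop m f) n = {k. k + m \<in> rpos f n}"
proof (induction n)
  case (Suc n)
  have "{k \<in> rpos (seq_drop m f) n. ptype n (seq_drop k (seq_drop m f))}
      = {k. k + m \<in> {k \<in> rpos f n. ptype n (seq_drop k f)}}"
    by (simp add: Suc)
  then show ?case
    using Suc finite_add_iff[of m "{k \<in> rpos f n. ptype n (seq_drop k f)}"]
    by (simp del: seq_drop_apply)
qed simp

lemma rpos_cong: "geq f f' \<Longrightarrow> rpos f n = rpos f' n"
proof (induction n)
  case (Suc n)
  then show ?case using ptype_cong[OF geq_seq_drop[OF Suc.prems]] by simp
qed simp

lemma rpos_ptype:
  "k \<in> rpos f (Suc n) \<Longrightarrow> k' \<in> rpos f (Suc n) \<Longrightarrow> ptype n (seq_drop k f) \<longleftrightarrow> ptype n (seq_drop k' f)"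
  by (auto split: if_splits)

definition rcore :: "(nat \<Rightarrow> 'v) \<Rightarrow> nat set" where
  "rcore f = (\<Inter>n. rpos f n)"

text \<open>Removing a finite core makes the first position in the \<open>n\<close>-th set tend to infinity.
  If the core is infinite, all the tails of \<open>f\<close> starting in it are \<open>G\<close>-equivalent, and a
  constant position is tail invariant.\<close>
definition mpos :: "(nat \<Rightarrow> 'v) \<Rightarrow> nat \<Rightarrow> nat set" where
  "mpos f n = (if infinite (rcore f) then rcore f else rpos f n - rcore f)"

lemma infinite_mpos: "infinite (mpos f n)"
  using infinite_rpos[of f n] by (auto simp: mpos_def)

lemma mpos_Suc_subset: "mpos f (Suc n) \<subseteq> mpos f n"
  using rpos_Suc_subset[of f n] by (auto simp: mpos_def simp del: rpos.simps)

lemma rcore_seq_drop: "rcore (seq_drop m f) = {k. k + m \<in> rcore f}"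
  by (auto simp: rcore_def rpos_seq_drop)

text \<open>Whether the core is infinite is tail invariant, so the ray and its tail fall under the
  same case of \<open>mpos\<close>.\<close>

lemma mpos_seq_drop: "mpos (seq_drop m f) n = {k. k + m \<in> mpos f n}"
  using finite_add_iff[of m "rcore f"] by (auto simp: mpos_def rcore_seq_drop rpos_seq_drop)

lemma rcore_cong: "geq f f' \<Longrightarrow> rcore f = rcore f'"
  by (simp add: rcore_def rpos_cong)

lemma mpos_cong: "geq f f' \<Longrightarrow> mpos f n = mpos f' n"
  by (simp add: mpos_def rcore_cong rpos_cong)

text \<open>Tails starting in the core give the same answer to every \<open>ptype j\<close>, and
  these predicates separate orbits.\<close>

lemma geq_rcore:
  assumes "f \<in> Geo" "k \<in> rcore f" "k' \<in> rcore f"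
  shows "geq (seq_drop k f) (seq_drop k' f)"
proof (rule geq_if_ptype)
  show "ptype j (seq_drop k f) \<longleftrightarrow> ptype j (seq_drop k' f)" for j
    using assms by (intro rpos_ptype) (auto simp: rcore_def simp del: rpos.simps)
qed (rule geodesics_seq_drop[OF assms(1)])+

section \<open>Cut tails and the gaps between them\<close>

definition mstart :: "(nat \<Rightarrow> 'v) \<Rightarrow> nat \<Rightarrow> nat" where
  "mstart f n = (LEAST k. k \<in> mpos f n)"

lemma mstart_in: "mstart f n \<in> mpos f n"
  unfolding mstart_def
  by (rule LeastI_ex) (use infinite_imp_nonempty[OF infinite_mpos] in blast)

lemma mstart_le: "k \<in> mpos f n \<Longrightarrow> mstart f n \<le> k"
  unfolding mstart_def by (rule Least_le)

lemma mstart_mono: "i \<le> j \<Longrightarrow> mstart f i \<le> mstart f j"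
  by (rule lift_Suc_mono_le[of "mstart f"])
    (rule mstart_le[OF subsetD[OF mpos_Suc_subset mstart_in]])

lemma mstart_cong: "geq f f' \<Longrightarrow> mstart f n = mstart f' n"
  by (simp add: mstart_def mpos_cong)

text \<open>The bound on \<open>m\<close> ensures that the drop does not skip the first position, so
  that position is merely renumbered.\<close>

lemma mstart_seq_drop:
  assumes "m \<le> mstart f n"
  shows "mstart f n = mstart (seq_drop m f) n + m"
proof (rule antisym)
  have "mstart (seq_drop m f) n + m \<in> mpos f n"
    using mstart_in[of "seq_drop m f" n] by (simp add: mpos_seq_drop)
  then show "mstart f n \<le> mstart (seq_drop m f) n + m" by (rule mstart_le)
  have "mstart f n - m \<in> mpos (seq_drop m f) n"
    using mstart_in[of f n] assms by (simp add: mpos_seq_drop)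
  then show "mstart (seq_drop m f) n + m \<le> mstart f n" using mstart_le assms by force
qed

definition mtail :: "nat \<Rightarrow> (nat \<Rightarrow> 'v) \<Rightarrow> nat \<Rightarrow> 'v" where
  "mtail n f = seq_drop (mstart f n) f"

lemma mtail_Geo: "f \<in> Geo \<Longrightarrow> mtail n f \<in> Geo"
  unfolding mtail_def by (rule geodesics_seq_drop)

definition mgap :: "nat \<Rightarrow> (nat \<Rightarrow> 'v) \<Rightarrow> nat" where
  "mgap n f = mstart f (Suc n) - mstart f n"

text \<open>Cuts move forward with \<open>n\<close>, so the gap can be read off the
  \<open>n\<close>-th tail alone. It therefore depends only on the orbit of that tail, which makes
  equivalence of cut tails persist at later stages.\<close>

lemma mgap_eq: "mgap n f = mstart (mtail n f) (Suc n)"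
  using mstart_seq_drop[of "mstart f n" f "Suc n"] mstart_mono[of n "Suc n" f]
  by (simp add: mgap_def mtail_def)

lemma mtail_Suc: "mtail (Suc n) f = seq_drop (mgap n f) (mtail n f)"
  using mstart_mono[of n "Suc n" f] by (simp add: mtail_def mgap_def)

lemma mgap_cong: "geq (mtail n f) (mtail n f') \<Longrightarrow> mgap n f = mgap n f'"
  by (simp add: mgap_eq mstart_cong)

lemma geq_mtail_Suc: "geq (mtail n f) (mtail n f') \<Longrightarrow> geq (mtail (Suc n) f) (mtail (Suc n) f')"
  using mgap_cong geq_seq_drop by (metis mtail_Suc)

text \<open>With the finite core removed, no position survives in all the decreasing sets
  \<open>mpos f n\<close>.\<close>

lemma mstart_unbounded:
  assumes "finite (rcore f)"
  shows "\<exists>i. \<forall>j\<ge>i. m \<le> mstart f j"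
proof (rule ccontr)
  assume "\<not> ?thesis"
  then have less: "\<exists>j\<ge>i. mstart f j < m" for i by (meson not_le)
  have "\<exists>i. k \<notin> mpos f i" for k using assms by (auto simp: mpos_def rcore_def simp del: rpos.simps)
  then obtain i where i: "\<And>k. k \<notin> mpos f (i k)" by metis
  have mono: "a \<le> b \<Longrightarrow> mpos f b \<subseteq> mpos f a" for a b
    using lift_Suc_antimono_le[of "mpos f"] mpos_Suc_subset by blast
  \<comment> \<open>By stage \<open>I\<close> every position up to \<open>m\<close> has left the
    sets.\<close>
  define I where "I = Max (i ` {..m})"
  obtain j where j: "j \<ge> I" "mstart f j < m" using less by blast
  then have "i (mstart f j) \<le> j"
    unfolding I_def by (meson Max_ge atMost_iff finite_atMost finite_imageI imageI le_trans less_imp_le)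
  then have "mstart f j \<notin> mpos f j" using i mono by blast
  then show False using mstart_in by blast
qed

text \<open>If the cores are infinite, stage 0 already works: both cuts lie in the cores and are
  compared through core positions that correspond under the given equivalence. If they are finite,
  some stage puts both cuts past the offsets \<open>m\<close> and \<open>n\<close>.\<close>

lemma tail_geq_imp_mtail_geq:
  assumes f: "f \<in> Geo" and f': "f' \<in> Geo" and eq: "geq (seq_drop m f) (seq_drop n f')"
  shows "\<exists>i. geq (mtail i f) (mtail i f')"
proof -
  have same: "{k. k + m \<in> rcore f} = {k. k + n \<in> rcore f'}"
    using rcore_cong[OF eq] by (simp add: rcore_seq_drop)
  have fin: "finite (rcore f) \<longleftrightarrow> finite (rcore f')"
    using finite_add_iff[of m "rcore f"] finite_add_iff[of n "rcore f'"] unfolding same by blast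
  show ?thesis
  proof (cases "finite (rcore f)")
    case False
    then have False': "infinite (rcore f')" using fin by blast
    have "infinite {k. k + m \<in> rcore f}" using False unfolding finite_add_iff .
    then obtain k where k: "k + m \<in> rcore f"
      using not_finite_existsD by blast
    then have k': "k + n \<in> rcore f'" using same by blast
    have "mstart f 0 \<in> rcore f" "mstart f' 0 \<in> rcore f'"
      using mstart_in[of f 0] mstart_in[of f' 0] False False' by (auto simp: mpos_def)
    then have "geq (mtail 0 f) (seq_drop (k + m) f)" "geq (seq_drop (k + n) f') (mtail 0 f')"
      unfolding mtail_def using geq_rcore f f' k k' by auto
    moreover have "geq (seq_drop (k + m) f) (seq_drop (k + n) f')"
      using geq_seq_drop[OF eq, of k] by simp
    ultimately show ?thesis using geq_trans by blast
  next
    case True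
    then have True': "finite (rcore f')" using fin by blast
    obtain i i' where i: "\<forall>j\<ge>i. m \<le> mstart f j" "\<forall>j\<ge>i'. n \<le> mstart f' j"
      using mstart_unbounded True True' by metis
    define j where "j = max i i'"
    have j: "m \<le> mstart f j" "n \<le> mstart f' j" using i by (auto simp: j_def)
    \<comment> \<open>Measured from the starts of the two equivalent tails, both cuts have the same
      offset \<open>d\<close>.\<close>
    define d where "d = mstart (seq_drop m f) j"
    have "d = mstart (seq_drop n f') j" unfolding d_def by (rule mstart_cong[OF eq])
    then have "mtail j f = seq_drop d (seq_drop m f)" "mtail j f' = seq_drop d (seq_drop n f')"
      using mstart_seq_drop[OF j(1)] mstart_seq_drop[OF j(2)] by (auto simp: mtail_def d_def)
    then show ?thesis using geq_seq_drop[OF eq, of d] by metis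
  qed
qed

section \<open>Stabilizing lengths and labels\<close>

definition stab_len :: "(nat \<Rightarrow> 'v) \<Rightarrow> nat" where
  "stab_len f = (LEAST n. stab_prefix G \<phi> f n = stab_seq G \<phi> f)"

lemma stab_len: "f \<in> Geo \<Longrightarrow> stab_prefix G \<phi> f (stab_len f) = stab_seq G \<phi> f"
  unfolding stab_len_def by (rule LeastI_ex[OF stab])

lemma stab_prefix_eq_stab_seq_iff:
  "stab_prefix G \<phi> f n = stab_seq G \<phi> f \<longleftrightarrow>
     (\<forall>g\<in>carrier G. (\<forall>i<n. \<phi> g (f i) = f i) \<longrightarrow> (\<forall>i. \<phi> g (f i) = f i))"
  unfolding stab_prefix_def stab_seq_def by blast

text \<open>Stabilizers of equivalent rays are conjugate. Concretely, \<open>h \<otimes> g\<close>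
  and \<open>g\<close> agree on the first \<open>n\<close> vertices of \<open>f\<close>, hence on
  all of them.\<close>

lemma stab_prefix_mono:
  assumes "geq f f'" "stab_prefix G \<phi> f n = stab_seq G \<phi> f"
  shows "stab_prefix G \<phi> f' n = stab_seq G \<phi> f'"
  unfolding stab_prefix_eq_stab_seq_iff
proof (intro ballI impI allI)
  fix h i assume h: "h \<in> carrier G" "\<forall>i<n. \<phi> h (f' i) = f' i"
  obtain g where g: "g \<in> carrier G" "\<And>k. \<phi> g (f k) = f' k" and f: "f \<in> Geo"
    using assms(1) by (auto simp: geq_def)
  have inV: "f i \<in> V" for i using f by (rule geodesics_in_vertices)
  have "\<phi> (h \<otimes> g) (f i) = \<phi> g (f i)"
    by (rule stab_prefix_extend[OF f assms(2)]) (use h g inV in \<open>auto simp: act_mult G_closed\<close>)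
  then show "\<phi> h (f' i) = f' i" using g h inV by (simp add: act_mult)
qed

lemma stab_len_cong: "geq f f' \<Longrightarrow> stab_len f = stab_len f'"
  unfolding stab_len_def using stab_prefix_mono geq_sym by metis

text \<open>Some \<open>h\<close> matches the tails. After the first \<open>d\<close> vertices,
  \<open>g\<close> agrees with \<open>h\<close> on a stabilizing prefix of the tail, so it agrees
  with \<open>h\<close> throughout.\<close>

lemma prefix_determines:
  assumes f: "f \<in> Geo" and f': "f' \<in> Geo" and tail: "geq (seq_drop d f) (seq_drop d f')"
    and g: "g \<in> carrier G" and pre: "\<And>i. i < d + stab_len (seq_drop d f) \<Longrightarrow> \<phi> g (f i) = f' i"
  shows "\<phi> g (f k) = f' k"
proof (cases "k < d")
  case True then show ?thesis using pre by simp
next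
  case False
  obtain h where h: "h \<in> carrier G" "\<And>k. \<phi> h (f (k + d)) = f' (k + d)"
    using tail by (auto simp: geq_def)
  have fd: "seq_drop d f \<in> Geo" using f by (rule geodesics_seq_drop)
  have "\<phi> g (seq_drop d f (k - d)) = \<phi> h (seq_drop d f (k - d))"
    by (rule stab_prefix_extend[OF fd stab_len[OF fd] g h(1)]) (use pre h in auto)
  then show ?thesis using h False by (metis le_add_diff_inverse2 not_less seq_drop_apply)
qed

text \<open>A complete invariant with values in the naturals for orbits of finite words: the first
  enumerated word in the orbit is its canonical representative.\<close>

definition orbit_index :: "'v list \<Rightarrow> nat" where
  "orbit_index xs = (LEAST j. \<exists>g\<in>carrier G. map (\<phi> g) xs = wordn j)"

lemma orbit_index_cong:
  assumes "xs \<in> lists V" "g \<in> carrier G" "map (\<phi> g) xs = ys"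
  shows "orbit_index xs = orbit_index ys"
proof -
  have "(\<exists>h\<in>carrier G. map (\<phi> h) xs = z) \<longleftrightarrow> (\<exists>h\<in>carrier G. map (\<phi> h) ys = z)" for z
  proof
    assume "\<exists>h\<in>carrier G. map (\<phi> h) xs = z"
    then obtain h where h: "h \<in> carrier G" "map (\<phi> h) xs = z" by blast
    have "\<phi> (h \<otimes> inv g) (\<phi> g x) = \<phi> h x" if "x \<in> V" for x
      using that h assms by (simp add: act_mult act_closed G_closed act_inv_act)
    then have "map (\<phi> (h \<otimes> inv g)) ys = z" using assms h by auto
    then show "\<exists>h\<in>carrier G. map (\<phi> h) ys = z" using assms h G_closed by blast
  next
    assume "\<exists>h\<in>carrier G. map (\<phi> h) ys = z"
    then obtain h where h: "h \<in> carrier G" "map (\<phi> h) ys = z" by blast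
    then have "map (\<phi> (h \<otimes> g)) xs = z" using assms by (auto simp: act_mult)
    then show "\<exists>h\<in>carrier G. map (\<phi> h) xs = z" using assms h G_closed by blast
  qed
  then show ?thesis unfolding orbit_index_def by simp
qed

lemma orbit_index_ex:
  assumes "xs \<in> lists V"
  shows "\<exists>g\<in>carrier G. map (\<phi> g) xs = wordn (orbit_index xs)"
  unfolding orbit_index_def
proof (rule LeastI_ex)
  obtain j where "wordn j = xs" using ex_wordn assms by blast
  then show "\<exists>j. \<exists>g\<in>carrier G. map (\<phi> g) xs = wordn j"
    using assms by (intro exI[of _ j] bexI[of _ \<one>]) (auto simp: act_one G_closed intro!: map_idI)
qed

lemma orbit_index_eqD:
  assumes xs: "xs \<in> lists V" and ys: "ys \<in> lists V" and eq: "orbit_index xs = orbit_index ys"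
  shows "\<exists>g\<in>carrier G. map (\<phi> g) xs = ys"
proof -
  obtain g h where gh: "g \<in> carrier G" "h \<in> carrier G" "map (\<phi> g) xs = map (\<phi> h) ys"
    using orbit_index_ex[OF xs] orbit_index_ex[OF ys] eq by metis
  have "map (\<phi> (inv h \<otimes> g)) xs = map (\<phi> (inv h)) (map (\<phi> g) xs)"
    using xs gh(1,2) by (auto simp: act_mult G_closed)
  also have "\<dots> = ys"
    unfolding gh(3) using ys gh by (auto intro!: map_idI simp: act_inv_act)
  finally show ?thesis using gh G_closed by blast
qed

text \<open>The entries before the cut together with a stabilizing prefix of what follows, as
  \<open>prefix_determines\<close> demands.\<close>

definition prefix_len :: "nat \<Rightarrow> (nat \<Rightarrow> 'v) \<Rightarrow> nat" where
  "prefix_len d f = d + stab_len (seq_drop d f)"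

text \<open>The two components of a label determine, up to \<open>G\<close>, the \<open>n\<close>-th tail from the next one;
  label \<open>0\<close> recovers the ray itself.\<close>
primrec label :: "nat \<Rightarrow> (nat \<Rightarrow> 'v) \<Rightarrow> nat" where
  "label 0 f = prod_encode (mstart f 0,
     to_nat_on (lists V) (map f [0..<prefix_len (mstart f 0) f]))"
| "label (Suc n) f = prod_encode (mgap n f,
     orbit_index (map (mtail n f) [0..<prefix_len (mgap n f) (mtail n f)]))"

lemma map_lists: "f \<in> Geo \<Longrightarrow> map f xs \<in> lists V"
  using geodesics_in_vertices by auto

text \<open>Label 0 encodes the prefix itself and not only its orbit, so
  \<open>prefix_determines\<close> applies with \<open>\<one>\<close> and gives equality rather than
  equivalence.\<close>

lemma label_0_sep:
  assumes f: "f \<in> Geo" and f': "f' \<in> Geo" and eq: "label 0 f = label 0 f'"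
    and tail: "geq (mtail 0 f) (mtail 0 f')"
  shows "f = f'"
proof
  fix k
  define d where "d = mstart f 0"
  have d': "mstart f' 0 = d" using eq by (simp add: d_def)
  have "map f [0..<prefix_len d f] = map f' [0..<prefix_len d f']"
    using eq countable_V f f' map_lists by (simp add: d_def d' to_nat_on_inj)
  then have pre: "f i = f' i" if "i < prefix_len d f" for i
    using that by (metis add_0 diff_zero length_map length_upt nth_map_upt)
  have "geq (seq_drop d f) (seq_drop d f')"
    using tail unfolding mtail_def d' d_def .
  then have "\<phi> \<one> (f k) = f' k"
  proof (rule prefix_determines[OF f f'])
    fix i assume "i < d + stab_len (seq_drop d f)"
    then have "f i = f' i" using pre by (simp add: prefix_len_def)
    then show "\<phi> \<one> (f i) = f' i" using act_one geodesics_in_vertices[OF f] by metis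
  qed (rule G_closed)
  then show "f k = f' k" using f by (simp add: act_one geodesics_in_vertices)
qed

text \<open>Equal orbit indices provide one \<open>g\<close> between the two prefixes, which are
  long enough for \<open>prefix_determines\<close> to extend it to the whole \<open>n\<close>-th
  tails.\<close>

lemma label_Suc_sep:
  assumes f: "f \<in> Geo" and f': "f' \<in> Geo" and eq: "label (Suc n) f = label (Suc n) f'"
    and tail: "geq (mtail (Suc n) f) (mtail (Suc n) f')"
  shows "geq (mtail n f) (mtail n f')"
proof -
  let ?f = "mtail n f" and ?f' = "mtail n f'"
  have Geo: "?f \<in> Geo" "?f' \<in> Geo" using f f' mtail_Geo by auto
  define d where "d = mgap n f"
  have d': "mgap n f' = d" using eq by (simp add: d_def)
  obtain g where g: "g \<in> carrier G" "map (\<phi> g) (map ?f [0..<prefix_len d ?f]) = map ?f' [0..<prefix_len d ?f']"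
    using orbit_index_eqD[OF map_lists[OF Geo(1)] map_lists[OF Geo(2)]] eq
    by (fastforce simp: d_def d')
  have len: "prefix_len d ?f = prefix_len d ?f'" using arg_cong[OF g(2), of length] by simp
  have pre: "\<phi> g (?f i) = ?f' i" if "i < prefix_len d ?f" for i
    using arg_cong[OF g(2), of "\<lambda>xs. xs ! i"] that by (simp add: len)
  have "geq (seq_drop d ?f) (seq_drop d ?f')"
    using tail unfolding mtail_Suc d' by (simp add: d_def)
  then have "\<phi> g (?f k) = ?f' k" for k
    using prefix_determines[OF Geo _ g(1)] pre unfolding prefix_len_def by blast
  then show ?thesis using geqI Geo g(1) by blast
qed

text \<open>Gap, stabilizing length and orbit index are all invariant under \<open>geq\<close>. The
  label has index \<open>Suc n\<close> because \<open>bdry_rel (Suc n)\<close> will compare the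
  \<open>n\<close>-th tails.\<close>

lemma label_cong:
  assumes tail: "geq (mtail n f) (mtail n f')"
  shows "label (Suc n) f = label (Suc n) f'"
proof -
  let ?f = "mtail n f" and ?f' = "mtail n f'"
  obtain g where g: "g \<in> carrier G" "\<And>k. \<phi> g (?f k) = ?f' k" using tail by (auto simp: geq_def)
  have d: "mgap n f' = mgap n f" using mgap_cong[OF tail] by simp
  have N: "prefix_len (mgap n f) ?f' = prefix_len (mgap n f) ?f"
    using stab_len_cong[OF geq_seq_drop[OF tail]] by (simp add: prefix_len_def)
  have "orbit_index (map ?f [0..<N]) = orbit_index (map ?f' [0..<N])" for N
    by (rule orbit_index_cong[OF _ g(1)]) (use g map_lists geq_Geo[OF tail] in auto)
  then show ?thesis by (simp add: d N)
qed

subsection \<open>Measurability of the cuts and labels\<close>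

text \<open>The source \<open>N\<close> is arbitrary so that the same facts serve on
  \<open>Geo_space\<close>, on the boundary and on its square.\<close>

definition measurable_seq :: "'x measure \<Rightarrow> ('x \<Rightarrow> nat \<Rightarrow> 'v) \<Rightarrow> bool" where
  "measurable_seq N r \<longleftrightarrow> (\<forall>k. (\<lambda>x. r x k) \<in> measurable N (count_space V))"

lemma measurable_seqI: "(\<And>k. (\<lambda>x. r x k) \<in> measurable N (count_space V)) \<Longrightarrow> measurable_seq N r"
  by (simp add: measurable_seq_def)

lemma measurable_seqD: "measurable_seq N r \<Longrightarrow> (\<lambda>x. r x k) \<in> measurable N (count_space V)"
  by (simp add: measurable_seq_def)

lemma measurable_seq_drop:
  assumes r: "measurable_seq N r" and n: "n \<in> measurable N (count_space UNIV)"
  shows "measurable_seq N (\<lambda>x. seq_drop (n x) (r x))"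
  unfolding measurable_seq_def
proof
  show "(\<lambda>x. seq_drop (n x) (r x) k) \<in> measurable N (count_space V)" for k
    by (rule measurable_compose_countable[OF _ n, where f = "\<lambda>n x. seq_drop n (r x) k"])
      (simp add: measurable_seqD[OF r])
qed

lemma pred_measurable_seq:
  "measurable_seq N r \<Longrightarrow> measurable_seq N r' \<Longrightarrow> Measurable.pred N (\<lambda>x. P (r x i) (r' x j))"
  by (rule measurable_count_space_apply2[OF countable_V measurable_seqD measurable_seqD]) auto

lemma measurable_map:
  assumes "measurable_seq N r"
  shows "(\<lambda>x. map (r x) ks) \<in> measurable N (count_space (lists V))"
proof (induction ks)
  case (Cons k ks)
  have "(\<lambda>x. r x k # map (r x) ks) \<in> measurable N (count_space (lists V))"
    by (rule measurable_count_space_apply2[OF countable_V measurable_seqD[OF assms] Cons.IH]) auto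
  then show ?case by simp
qed simp

text \<open>The length varies with the point; splitting over its countably many values reduces to
  prefixes of fixed length.\<close>

lemma measurable_prefix:
  assumes r: "measurable_seq N r" and n: "n \<in> measurable N (count_space UNIV)"
    and c: "c \<in> lists V \<rightarrow> C"
  shows "(\<lambda>x. c (map (r x) [0..<n x])) \<in> measurable N (count_space C)"
  by (rule measurable_compose_countable[OF _ n, where f = "\<lambda>n x. c (map (r x) [0..<n])"])
    (rule measurable_compose[OF measurable_map[OF r]], use c in simp)

lemma pred_ptype:
  assumes r: "measurable_seq N r"
  shows "Measurable.pred N (\<lambda>x. ptype j (r x))"
  unfolding ptype_def
  by (rule measurable_compose[OF measurable_map[OF r],
        where g = "\<lambda>xs. \<exists>g\<in>carrier G. map (\<phi> g) (wordn j) = xs"]) simp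

lemma pred_rpos:
  assumes r: "measurable_seq N r"
  shows "Measurable.pred N (\<lambda>x. k \<in> rpos (r x) n)"
proof (induction n arbitrary: k)
  case (Suc n)
  note Suc.IH [measurable] pred_ptype[OF measurable_seq_drop[OF r measurable_const], measurable]
  \<comment> \<open>A position is kept iff its answer is the recurring one; infinity is expressed by
    countable quantifiers.\<close>
  have *: "(k \<in> rpos (r x) (Suc n)) \<longleftrightarrow> k \<in> rpos (r x) n \<and>
    (ptype n (seq_drop k (r x)) \<longleftrightarrow> (\<forall>m. \<exists>k\<ge>m. k \<in> rpos (r x) n \<and> ptype n (seq_drop k (r x))))" for x
    by (simp add: infinite_nat_iff_unbounded_le) blast
  show ?case unfolding * by measurable
qed simp

lemma pred_rcore:
  assumes r: "measurable_seq N r"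
  shows "Measurable.pred N (\<lambda>x. k \<in> rcore (r x))"
proof -
  note pred_rpos[OF r, measurable]
  have *: "k \<in> rcore (r x) \<longleftrightarrow> (\<forall>n. k \<in> rpos (r x) n)" for x
    by (simp add: rcore_def)
  show ?thesis unfolding * by measurable
qed

lemma pred_mpos:
  assumes r: "measurable_seq N r"
  shows "Measurable.pred N (\<lambda>x. k \<in> mpos (r x) n)"
proof -
  note pred_rpos[OF r, measurable] pred_rcore[OF r, measurable]
  have *: "k \<in> mpos (r x) n \<longleftrightarrow> (if \<forall>m. \<exists>k\<ge>m. k \<in> rcore (r x) then k \<in> rcore (r x)
    else k \<in> rpos (r x) n \<and> k \<notin> rcore (r x))" for x
    by (simp add: mpos_def flip: infinite_nat_iff_unbounded_le)
  show ?thesis unfolding * by measurable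
qed

lemma measurable_mstart:
  assumes r: "measurable_seq N r"
  shows "(\<lambda>x. mstart (r x) n) \<in> measurable N (count_space UNIV)"
  unfolding mstart_def by (rule measurable_Least) (rule pred_mpos[OF r])

lemma measurable_mgap:
  assumes r: "measurable_seq N r"
  shows "(\<lambda>x. mgap n (r x)) \<in> measurable N (count_space UNIV)"
proof -
  note measurable_mstart[OF r, measurable]
  show ?thesis unfolding mgap_def by measurable
qed

lemma measurable_mtail: "measurable_seq N r \<Longrightarrow> measurable_seq N (\<lambda>x. mtail n (r x))"
  unfolding mtail_def by (intro measurable_seq_drop measurable_mstart)

text \<open>Countability of \<open>G\<close> turns the comparison of the two stabilizers into
  countably many conditions on coordinates.\<close>

lemma measurable_stab_len:
  assumes r: "measurable_seq N r"
  shows "(\<lambda>x. stab_len (r x)) \<in> measurable N (count_space UNIV)"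
  unfolding stab_len_def stab_prefix_eq_stab_seq_iff
proof (intro measurable_Least pred_countable_Ball[OF countable_G])
  fix n g
  have [measurable]: "Measurable.pred N (\<lambda>x. \<phi> g (r x i) = r x i)" for i
    using pred_measurable_seq[OF r r] .
  show "Measurable.pred N (\<lambda>x. (\<forall>i<n. \<phi> g (r x i) = r x i) \<longrightarrow> (\<forall>i. \<phi> g (r x i) = r x i))"
    by measurable
qed

lemma measurable_prefix_len:
  assumes r: "measurable_seq N r" and d[measurable]: "d \<in> measurable N (count_space UNIV)"
  shows "(\<lambda>x. prefix_len (d x) (r x)) \<in> measurable N (count_space UNIV)"
proof -
  note measurable_stab_len[OF measurable_seq_drop[OF r d], measurable]
  show ?thesis unfolding prefix_len_def by measurable
qed

lemma measurable_label:
  assumes r: "measurable_seq N r"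
  shows "(\<lambda>x. label n (r x)) \<in> measurable N (count_space UNIV)"
proof (cases n)
  case 0
  note measurable_mstart[OF r, measurable]
  have [measurable]: "(\<lambda>x. to_nat_on (lists V) (map (r x) [0..<prefix_len (mstart (r x) 0) (r x)]))
    \<in> measurable N (count_space UNIV)"
    by (intro measurable_prefix measurable_prefix_len measurable_mstart r) simp
  have "(\<lambda>x. prod_encode (mstart (r x) 0,
      to_nat_on (lists V) (map (r x) [0..<prefix_len (mstart (r x) 0) (r x)])))
    \<in> measurable N (count_space UNIV)"
    by measurable
  then show ?thesis using 0 by simp
next
  case (Suc m)
  note measurable_mgap[OF r, measurable]
  have [measurable]: "(\<lambda>x. orbit_index (map (mtail m (r x)) [0..<prefix_len (mgap m (r x)) (mtail m (r x))]))
    \<in> measurable N (count_space UNIV)"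
    by (intro measurable_prefix measurable_prefix_len measurable_mgap measurable_mtail r) simp
  have "(\<lambda>x. prod_encode (mgap m (r x),
      orbit_index (map (mtail m (r x)) [0..<prefix_len (mgap m (r x)) (mtail m (r x))])))
    \<in> measurable N (count_space UNIV)"
    by measurable
  then show ?thesis using Suc by simp
qed

lemma pred_act_eq:
  assumes r: "measurable_seq N r" and r': "measurable_seq N r'"
  shows "Measurable.pred N (\<lambda>x. \<exists>g\<in>carrier G. \<forall>k. \<phi> g (r x k) = r' x k)"
proof (rule pred_countable_Bex[OF countable_G])
  fix g
  have [measurable]: "Measurable.pred N (\<lambda>x. \<phi> g (r x k) = r' x k)" for k
    using pred_measurable_seq[OF r r'] .
  show "Measurable.pred N (\<lambda>x. \<forall>k. \<phi> g (r x k) = r' x k)" by measurable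
qed

lemma pred_geodesic:
  assumes r: "measurable_seq N r"
  shows "Measurable.pred N (\<lambda>x. r x \<in> Geo)"
proof -
  have [measurable]: "Measurable.pred N (\<lambda>x. r x i = r x j)" "Measurable.pred N (\<lambda>x. adj (r x i) (r x j))"
    "Measurable.pred N (\<lambda>x. r x i \<in> V)" for i j
    using pred_measurable_seq[OF r r, of "(=)" i j] pred_measurable_seq[OF r r, of adj i j]
      pred_measurable_seq[OF r r, of "\<lambda>u _. u \<in> V" i j] by simp_all
  show ?thesis unfolding geodesics_def inj_def mem_Collect_eq by measurable
qed

section \<open>Rays from a base vertex\<close>

definition base_vertex :: 'v where
  "base_vertex = (SOME v. v \<in> V)"

text \<open>By \<open>ray_ex\<close> and \<open>ray_unique\<close> the choice has exactly one
  candidate in each boundary class, so this is a canonical section of the quotient map.\<close>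

definition ray :: "(nat \<Rightarrow> 'v) set \<Rightarrow> nat \<Rightarrow> 'v" where
  "ray \<xi> = (SOME f. f \<in> \<xi> \<and> f 0 = base_vertex)"

lemma boundary_eq_class:
  assumes "\<xi> \<in> boundary V adj" "f \<in> \<xi>"
  shows "\<xi> = shift_rel V adj `` {f}"
proof -
  obtain h where h: "\<xi> = shift_rel V adj `` {h}"
    using assms(1) unfolding boundary_def by (rule quotientE)
  then have "(h, f) \<in> shift_rel V adj" using assms(2) by blast
  then show ?thesis unfolding h by (rule equiv_class_eq[OF equiv_shift_rel])
qed

lemma boundary_subset: "\<xi> \<in> boundary V adj \<Longrightarrow> \<xi> \<subseteq> Geo"
  unfolding boundary_def using equiv_shift_rel by (rule in_quotient_imp_subset)

lemma ray_ex:
  assumes "\<xi> \<in> boundary V adj"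
  shows "\<exists>f. f \<in> \<xi> \<and> f 0 = base_vertex"
proof -
  obtain f where f: "f \<in> \<xi>"
    using in_quotient_imp_non_empty[OF equiv_shift_rel] assms unfolding boundary_def by blast
  then have fG: "f \<in> Geo" using assms boundary_subset by blast
  \<comment> \<open>The class contains a ray, so \<open>V\<close> is nonempty and the choice of
    \<open>base_vertex\<close> is proper.\<close>
  have "base_vertex \<in> V"
    unfolding base_vertex_def using geodesics_in_vertices[OF fG] by (metis someI_ex)
  then obtain h m n where h: "h \<in> Geo" "h 0 = base_vertex" "seq_drop m h = seq_drop n f"
    using ex_geodesic_from[OF tree fG] by blast
  then have "(f, h) \<in> shift_rel V adj" using fG by (metis shift_rel_iff)
  then have "h \<in> \<xi>" using boundary_eq_class[OF assms f] by blast
  then show ?thesis using h by blast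
qed

lemma ray_in: "\<xi> \<in> boundary V adj \<Longrightarrow> ray \<xi> \<in> \<xi>"
  and ray_0: "\<xi> \<in> boundary V adj \<Longrightarrow> ray \<xi> 0 = base_vertex"
  unfolding ray_def using someI_ex[OF ray_ex] by blast+

lemma ray_Geo: "\<xi> \<in> boundary V adj \<Longrightarrow> ray \<xi> \<in> Geo"
  using ray_in boundary_subset by blast

lemma mem_boundary_iff:
  assumes "\<xi> \<in> boundary V adj"
  shows "f \<in> \<xi> \<longleftrightarrow> f \<in> Geo \<and> (\<exists>m n. seq_drop m (ray \<xi>) = seq_drop n f)"
proof -
  have "f \<in> \<xi> \<longleftrightarrow> (ray \<xi>, f) \<in> shift_rel V adj"
    using boundary_eq_class[OF assms ray_in[OF assms]] by blast
  then show ?thesis using ray_Geo[OF assms] by (simp only: shift_rel_iff simp_thms)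
qed

lemma ray_unique:
  assumes "\<xi> \<in> boundary V adj" "f \<in> \<xi>" "f 0 = base_vertex"
  shows "ray \<xi> = f"
proof -
  obtain m n where "f \<in> Geo" "seq_drop m (ray \<xi>) = seq_drop n f"
    using assms(2) mem_boundary_iff[OF assms(1)] by blast
  then show ?thesis
    using geodesics_eqI[OF tree ray_Geo[OF assms(1)]] ray_0[OF assms(1)] assms(3) by simp
qed

lemma ray_inj:
  assumes "\<xi> \<in> boundary V adj" "\<eta> \<in> boundary V adj" "ray \<xi> = ray \<eta>"
  shows "\<xi> = \<eta>"
  using boundary_eq_class[OF assms(1) ray_in[OF assms(1)]]
    boundary_eq_class[OF assms(2) ray_in[OF assms(2)]] unfolding assms(3) by (rule trans[OF _ sym])

lemma ray_eq_iff:
  "\<xi> \<in> boundary V adj \<Longrightarrow> \<eta> \<in> boundary V adj \<Longrightarrow> ray \<xi> = ray \<eta> \<longleftrightarrow> \<xi> = \<eta>"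
  using ray_inj by blast

lemma class_in_boundary: "f \<in> Geo \<Longrightarrow> \<exists>\<xi>\<in>boundary V adj. f \<in> \<xi>"
  using Union_quotient[OF equiv_shift_rel, of V adj] unfolding boundary_def by blast

text \<open>Borel sets of the boundary are tested on unions of classes. For \<open>f\<close> in a
  class, its base ray is a finite word followed by a tail of \<open>f\<close>, so the choice in
  \<open>ray\<close> becomes a quantifier over countably many words and shifts.\<close>

lemma Union_ray_eq:
  "\<Union>{\<xi> \<in> boundary V adj. ray \<xi> k = v} = {f \<in> Geo. \<exists>xs\<in>lists V. \<exists>m.
     seq_append xs (seq_drop m f) \<in> Geo \<and> seq_append xs (seq_drop m f) 0 = base_vertex \<and>
     seq_append xs (seq_drop m f) k = v}" (is "?L = ?R")
proof
  show "?L \<subseteq> ?R"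
  proof
    fix f assume "f \<in> ?L"
    then obtain \<xi> where \<xi>: "\<xi> \<in> boundary V adj" "f \<in> \<xi>" "ray \<xi> k = v" by blast
    then obtain m n where f: "f \<in> Geo" "seq_drop m (ray \<xi>) = seq_drop n f"
      using mem_boundary_iff by blast
    define xs where "xs = map (ray \<xi>) [0..<m]"
    have "seq_append xs (seq_drop n f) = ray \<xi>"
      unfolding xs_def f(2)[symmetric] by (rule seq_append_prefix_seq_drop)
    moreover have "xs \<in> lists V" unfolding xs_def by (rule map_lists[OF ray_Geo[OF \<xi>(1)]])
    ultimately show "f \<in> ?R" using \<xi> f ray_Geo ray_0 by (intro CollectI conjI bexI[of _ xs] exI[of _ n]) auto
  qed
  show "?R \<subseteq> ?L"
  proof
    fix f assume "f \<in> ?R"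
    then obtain xs m where f: "f \<in> Geo" and h: "seq_append xs (seq_drop m f) \<in> Geo"
      "seq_append xs (seq_drop m f) 0 = base_vertex" "seq_append xs (seq_drop m f) k = v" by blast
    let ?h = "seq_append xs (seq_drop m f)"
    obtain \<xi> where \<xi>: "\<xi> \<in> boundary V adj" "f \<in> \<xi>" using class_in_boundary[OF f] by blast
    have "(f, ?h) \<in> shift_rel V adj" using f h(1) seq_drop_seq_append by (metis shift_rel_iff)
    then have "?h \<in> \<xi>" using boundary_eq_class[OF \<xi>] by blast
    then have "ray \<xi> = ?h" using ray_unique \<xi> h(2) by blast
    then show "f \<in> ?L" using \<xi> h(3) by auto
  qed
qed

lemma measurable_seq_ray: "measurable_seq (boundary_space V adj) ray"
proof (rule measurable_seqI)
  fix k
  let ?N = "Geo_space V adj"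
  \<comment> \<open>Since \<open>V\<close> is countable, preimages of single vertices
    suffice.\<close>
  have "{\<xi> \<in> boundary V adj. ray \<xi> k = v} \<in> sets (boundary_space V adj)" for v
  proof -
    have "Measurable.pred ?N (\<lambda>f. \<exists>xs\<in>lists V. \<exists>m.
     seq_append xs (seq_drop m f) \<in> Geo \<and> seq_append xs (seq_drop m f) 0 = base_vertex \<and>
     seq_append xs (seq_drop m f) k = v)"
    proof (rule pred_countable_Bex)
      fix xs assume xs: "xs \<in> lists V"
      have r: "measurable_seq ?N (\<lambda>f. seq_append xs (seq_drop m f))" for m
      proof (rule measurable_seqI)
        show "(\<lambda>f. seq_append xs (seq_drop m f) i) \<in> measurable ?N (count_space V)" for i
          using xs by (cases "i < length xs") (auto simp: seq_append_def measurable_Geo_component)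
      qed
      have [measurable]: "Measurable.pred ?N (\<lambda>f. seq_append xs (seq_drop m f) \<in> Geo)"
        "Measurable.pred ?N (\<lambda>f. seq_append xs (seq_drop m f) 0 = base_vertex)"
        "Measurable.pred ?N (\<lambda>f. seq_append xs (seq_drop m f) k = v)" for m
        using pred_geodesic[OF r, of m]
          pred_measurable_seq[OF r r, of "\<lambda>u _. u = base_vertex" m 0 m 0]
          pred_measurable_seq[OF r r, of "\<lambda>u _. u = v" m k m k] by simp_all
      show "Measurable.pred ?N (\<lambda>f. \<exists>m. seq_append xs (seq_drop m f) \<in> Geo \<and>
        seq_append xs (seq_drop m f) 0 = base_vertex \<and> seq_append xs (seq_drop m f) k = v)"
        by measurable
    qed (simp add: countable_V)
    then have "\<Union>{\<xi> \<in> boundary V adj. ray \<xi> k = v} \<in> sets ?N"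
      unfolding Union_ray_eq pred_def space_Geo_space .
    then show ?thesis unfolding sets_boundary_space by blast
  qed
  moreover have "(\<lambda>\<xi>. ray \<xi> k) -` {v} \<inter> space (boundary_space V adj)
    = {\<xi> \<in> boundary V adj. ray \<xi> k = v}" for v
    unfolding space_boundary_space by blast
  ultimately show "(\<lambda>\<xi>. ray \<xi> k) \<in> measurable (boundary_space V adj) (count_space V)"
    unfolding measurable_count_space_eq_countable[OF countable_V]
    by (simp add: space_boundary_space Pi_iff geodesics_in_vertices[OF ray_Geo])
qed

section \<open>Relations on the boundary and their union\<close>

primrec bdry_rel :: "nat \<Rightarrow> ((nat \<Rightarrow> 'v) set \<times> (nat \<Rightarrow> 'v) set) set" where
  "bdry_rel 0 = {(\<xi>, \<eta>). \<xi> \<in> boundary V adj \<and> \<eta> \<in> boundary V adj \<and> \<xi> = \<eta>}"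
| "bdry_rel (Suc n) = {(\<xi>, \<eta>). \<xi> \<in> boundary V adj \<and> \<eta> \<in> boundary V adj \<and>
     geq (mtail n (ray \<xi>)) (mtail n (ray \<eta>))}"

lemma equiv_bdry_rel: "equiv (boundary V adj) (bdry_rel n)"
proof (rule equivI)
  show "bdry_rel n \<subseteq> boundary V adj \<times> boundary V adj" by (cases n) auto
  show "refl_on (boundary V adj) (bdry_rel n)"
    by (cases n) (auto simp: refl_on_def ray_Geo mtail_Geo geq_refl)
  show "sym (bdry_rel n)" by (cases n) (auto simp: sym_def geq_sym)
  show "trans (bdry_rel n)" by (cases n) (auto simp: trans_def intro: geq_trans)
qed

lemma bdry_rel_measurable:
  "bdry_rel n \<in> sets (boundary_space V adj \<Otimes>\<^sub>M boundary_space V adj)"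
proof -
  let ?M = "boundary_space V adj"
  let ?N = "?M \<Otimes>\<^sub>M ?M"
  have sp: "space ?N = boundary V adj \<times> boundary V adj"
    by (simp add: space_pair_measure space_boundary_space)
  have r: "measurable_seq ?N (\<lambda>x. ray (fst x))" and r': "measurable_seq ?N (\<lambda>x. ray (snd x))"
    by (auto intro!: measurable_seqI measurable_compose[OF measurable_fst]
      measurable_compose[OF measurable_snd] measurable_seqD[OF measurable_seq_ray])
  show ?thesis
  proof (cases n)
    case 0
    \<comment> \<open>As \<open>ray\<close> is injective on the boundary, the diagonal is cut out by
      countably many coordinate equations.\<close>
    have eq: "bdry_rel n = {x \<in> space ?N. \<forall>k. ray (fst x) k = ray (snd x) k}"
      unfolding sp 0 fun_eq_iff[symmetric] by (auto simp: ray_eq_iff)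
    have [measurable]: "Measurable.pred ?N (\<lambda>x. ray (fst x) k = ray (snd x) k)" for k
      using pred_measurable_seq[OF r r'] .
    show ?thesis unfolding eq by measurable
  next
    case (Suc m)
    have "bdry_rel n = {x \<in> space ?N. \<exists>g\<in>carrier G. \<forall>k. \<phi> g (mtail m (ray (fst x)) k) = mtail m (ray (snd x)) k}"
      unfolding sp Suc by (simp add: set_eq_iff geq_def ray_Geo mtail_Geo cong: conj_cong)
    then show ?thesis
      using pred_act_eq[OF measurable_mtail[OF r, of m] measurable_mtail[OF r', of m]]
      by (simp add: pred_def)
  qed
qed

lemma bdry_rel_Suc: "bdry_rel n \<subseteq> bdry_rel (Suc n)"
  by (cases n) (auto simp: ray_Geo mtail_Geo geq_refl geq_mtail_Suc)

text \<open>Translating a class moves its base ray to a representative of the other class, though in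
  general not to its base ray; only tails can be compared.\<close>

lemma orbit_iff:
  assumes "\<xi> \<in> boundary V adj" "\<eta> \<in> boundary V adj"
  shows "(\<xi>, \<eta>) \<in> orbit_eqrel G (boundary_action \<phi>) (boundary V adj) \<longleftrightarrow>
    (\<exists>m n. geq (seq_drop m (ray \<xi>)) (seq_drop n (ray \<eta>)))"
proof
  assume "(\<xi>, \<eta>) \<in> orbit_eqrel G (boundary_action \<phi>) (boundary V adj)"
  then obtain g where g: "g \<in> carrier G" "boundary_action \<phi> g \<xi> = \<eta>" by (auto simp: orbit_eqrel_def)
  then have "\<phi> g \<circ> ray \<xi> \<in> \<eta>" using ray_in[OF assms(1)] by (auto simp: boundary_action_def)
  then obtain m n where "seq_drop m (ray \<eta>) = seq_drop n (\<phi> g \<circ> ray \<xi>)"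
    using mem_boundary_iff[OF assms(2)] by blast
  then have "\<phi> g (seq_drop n (ray \<xi>) k) = seq_drop m (ray \<eta>) k" for k
    by (metis comp_apply seq_drop_apply)
  then show "\<exists>m n. geq (seq_drop m (ray \<xi>)) (seq_drop n (ray \<eta>))"
    using geqI[OF _ _ g(1)] geodesics_seq_drop ray_Geo assms by metis
next
  assume "\<exists>m n. geq (seq_drop m (ray \<xi>)) (seq_drop n (ray \<eta>))"
  then obtain m n g where g: "g \<in> carrier G" "\<And>k. \<phi> g (seq_drop m (ray \<xi>) k) = seq_drop n (ray \<eta>) k"
    by (auto simp: geq_def)
  \<comment> \<open>An element matching tails of the two base rays carries every representative of
    the first class into the second. It is stated for general classes because it is used again with
    \<open>inv g\<close> and the classes exchanged.\<close>
  have move: "\<phi> h \<circ> f \<in> y" if x: "x \<in> boundary V adj" and y: "y \<in> boundary V adj" and h: "h \<in> carrier G"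
    and eq: "\<And>k. \<phi> h (seq_drop m (ray x) k) = seq_drop n (ray y) k" and f: "f \<in> x" for x y h m n f
  proof -
    obtain a b where ab: "f \<in> Geo" "seq_drop a (ray x) = seq_drop b f"
      using f mem_boundary_iff[OF x] by blast
    have "seq_drop (a + n) (ray y) = seq_drop (b + m) (\<phi> h \<circ> f)"
    proof
      fix k
      have "seq_drop (a + n) (ray y) k = \<phi> h (seq_drop a (ray x) (k + m))"
        using eq[of "k + a"] by (simp add: ac_simps)
      also have "\<dots> = seq_drop (b + m) (\<phi> h \<circ> f) k"
        unfolding ab(2) by (simp add: ac_simps)
      finally show "seq_drop (a + n) (ray y) k = seq_drop (b + m) (\<phi> h \<circ> f) k" .
    qed
    then show ?thesis using mem_boundary_iff[OF y] act_geodesic[OF h ab(1)] by blast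
  qed
  have "boundary_action \<phi> g \<xi> = \<eta>"
    unfolding boundary_action_def
  proof
    show "(\<lambda>f. \<phi> g \<circ> f) ` \<xi> \<subseteq> \<eta>" using move[OF assms g] by blast
    show "\<eta> \<subseteq> (\<lambda>f. \<phi> g \<circ> f) ` \<xi>"
    proof
      fix f assume f: "f \<in> \<eta>"
      have ig: "inv g \<in> carrier G" using g G_closed by blast
      have "\<phi> (inv g) (seq_drop n (ray \<eta>) k) = seq_drop m (ray \<xi>) k" for k
        by (rule act_inv[OF g(1) _ g(2)]) (simp add: geodesics_in_vertices[OF ray_Geo[OF assms(1)]])
      then have "\<phi> (inv g) \<circ> f \<in> \<xi>" using move[OF assms(2,1) ig _ f] by blast
      moreover have "\<phi> g (\<phi> (inv g) (f k)) = f k" for k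
      proof -
        have "f \<in> Geo" using f boundary_subset[OF assms(2)] by blast
        then show ?thesis
          using act_inv_act[OF ig geodesics_in_vertices] group.inv_inv[OF group_G g(1)] by simp
      qed
      then have "f = \<phi> g \<circ> (\<phi> (inv g) \<circ> f)" by auto
      ultimately show "f \<in> (\<lambda>f. \<phi> g \<circ> f) ` \<xi>" by blast
    qed
  qed
  then show "(\<xi>, \<eta>) \<in> orbit_eqrel G (boundary_action \<phi>) (boundary V adj)"
    using assms g(1) by (auto simp: orbit_eqrel_def)
qed

lemma orbit_eqrel_eq_UN:
  "orbit_eqrel G (boundary_action \<phi>) (boundary V adj) = (\<Union>n. bdry_rel n)"
proof (intro equalityI subsetI)
  fix p assume "p \<in> orbit_eqrel G (boundary_action \<phi>) (boundary V adj)"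
  then obtain \<xi> \<eta> where p: "p = (\<xi>, \<eta>)" "\<xi> \<in> boundary V adj" "\<eta> \<in> boundary V adj"
    "p \<in> orbit_eqrel G (boundary_action \<phi>) (boundary V adj)" by (auto simp: orbit_eqrel_def)
  then obtain i where "geq (mtail i (ray \<xi>)) (mtail i (ray \<eta>))"
    using orbit_iff tail_geq_imp_mtail_geq ray_Geo by blast
  then have "p \<in> bdry_rel (Suc i)" using p by simp
  then show "p \<in> (\<Union>n. bdry_rel n)" by blast
next
  fix p assume "p \<in> (\<Union>n. bdry_rel n)"
  \<comment> \<open>Passing to the next stage avoids stage 0, where the relation is equality and not
    a condition on tails.\<close>
  then obtain n where "p \<in> bdry_rel (Suc n)" using bdry_rel_Suc by blast
  then obtain \<xi> \<eta> where p: "p = (\<xi>, \<eta>)" "\<xi> \<in> boundary V adj" "\<eta> \<in> boundary V adj"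
    "geq (mtail n (ray \<xi>)) (mtail n (ray \<eta>))" by auto
  then show "p \<in> orbit_eqrel G (boundary_action \<phi>) (boundary V adj)"
    using orbit_iff unfolding mtail_def by blast
qed

lemma hyperfinite_boundary:
  "borel_hyperfinite (boundary_space V adj) (orbit_eqrel G (boundary_action \<phi>) (boundary V adj))"
  unfolding orbit_eqrel_eq_UN
proof (rule borel_hyperfinite_UN_labelled[where l = "\<lambda>n \<xi>. label n (ray \<xi>)"])
  show "equiv (space (boundary_space V adj)) (bdry_rel i)" for i
    unfolding space_boundary_space by (rule equiv_bdry_rel)
  \<comment> \<open>The relations were indexed from equality at stage 0 to meet this requirement;
    label 0 leads from stage 1 back to equality.\<close>
  show "bdry_rel 0 \<subseteq> Id" by auto
  show "label i (ray \<xi>) = label i (ray \<eta>)" if "(\<xi>, \<eta>) \<in> bdry_rel i" for i \<xi> \<eta>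
    using that label_cong by (cases i) (auto simp del: label.simps)
  show "(\<xi>, \<eta>) \<in> bdry_rel i"
    if "(\<xi>, \<eta>) \<in> bdry_rel (Suc i)" "label i (ray \<xi>) = label i (ray \<eta>)" for i \<xi> \<eta>
  proof (cases i)
    case 0
    then show ?thesis using that label_0_sep ray_Geo
      by (auto simp del: label.simps simp: ray_eq_iff[symmetric])
  next
    case (Suc m)
    then show ?thesis using that label_Suc_sep ray_Geo by (auto simp del: label.simps)
  qed
qed (rule bdry_rel_measurable bdry_rel_Suc measurable_label[OF measurable_seq_ray])+

end

theorem theorem3p2:
  fixes G :: "('g, 'b) monoid_scheme" (structure)
    and V :: "'v set" and adj :: "'v \<Rightarrow> 'v \<Rightarrow> bool"
    and \<phi> :: "'g \<Rightarrow> 'v \<Rightarrow> 'v"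
  assumes "countable (carrier G)"
    and "countable V"
    and "tree V adj"
    and "group_action G V \<phi>"
    and "\<forall>g\<in>carrier G. \<forall>u\<in>V. \<forall>v\<in>V. adj u v \<longleftrightarrow> adj (\<phi> g u) (\<phi> g v)"
    and "\<forall>f\<in>geodesics V adj. \<exists>n. stab_prefix G \<phi> f n = stab_seq G \<phi> f"
  shows "borel_hyperfinite (boundary_space V adj)
           (orbit_eqrel G (boundary_action \<phi>) (boundary V adj))"
proof -
  interpret tree_action G V adj \<phi>
    using assms by (intro tree_action.intro) auto
  show ?thesis by (rule hyperfinite_boundary)
qed

end
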